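(* Let $T=\begin{pmatrix} a & b\\ -\overline{b} & \overline{a}\end{pmatrix}$ be a special unitary $2\times 2$ matrix (so $a,b\in\mathbb{C}$, $|a|^2+|b|^2=1$) with $ab\neq 0$. Let $U(T)$ be the quantum walk on $\ell^2(\mathbb{Z},\mathbb{C}^2)$ associated with $T$, and let $D(T)$ be the bounded self-adjoint operator on $\ell^2(\mathbb{Z},\mathbb{C}^2)$ given by $D(T)=\sum_{y\in\mathbb{Z}}\mathcal{D}_T(y)\tau^y$ (both defined in the context). Then $$U(T)=e^{iD(T)}.$$
   Context: $\ell^2(\mathbb{Z},\mathbb{C}^2)$ is the Hilbert space of square summable $\mathbb{C}^2$-valued functions on $\mathbb{Z}$. The shift operator $\tau$ is $(\tau f)(x)=f(x-1)$. $2\times 2$ matrices act pointwise on $\ell^2(\mathbb{Z},\mathbb{C}^2)$. $P_i$ ($i=1,2$) is the orthogonal projection of $\mathbb{C}^2$ onto $\mathbb{C}\mathbf{e}_i$, where $\{\mathbf{e}_1,\mathbf{e}_2\}$ is the standard basis. The quantum walk associated with $T$ is the unitary operator $$U(T)=TP_1\tau+TP_2\tau^{-1}.$$ Set $s=|a|$, $r=|b|$, $\alpha=a/|a|$, $\beta=b/|b|$, and $\varphi_s(\theta)=\arccos(s\cos\theta)$ for $\theta\in\mathbb{R}$ (principal value in $[0,\pi]$). For $x\in\mathbb{Z}$ define $$I(x)=\frac{1}{2\pi}\int_0^{2\pi}e^{-ix\theta}\sin\theta\,\frac{\varphi_s(\theta)}{\sin\varphi_s(\theta)}\,d\theta,\qquad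 J(x)=\frac{1}{2\pi}\int_0^{2\pi}e^{-ix\theta}\frac{\varphi_s(\theta)}{\sin\varphi_s(\theta)}\,d\theta,$$ and $$\mathcal{D}_T(x)=\begin{pmatrix} s\alpha^x I(x) & -ir\alpha^{x+1}\beta J(x+1)\\ ir\alpha^{x-1}\beta^{-1}J(x-1) & -s\alpha^x I(x)\end{pmatrix}.$$ The operator $D(T)=\sum_{y\in\mathbb{Z}}\mathcal{D}_T(y)\tau^y$ is a bounded self-adjoint operator on $\ell^2(\mathbb{Z},\mathbb{C}^2)$. *)

theory Defs
  imports "HOL-Analysis.Analysis"
begin

section \<open>The Hilbert space of square summable functions\<close>

lemma square_summable_inner:
  fixes f g :: "'i \<Rightarrow> 'v::real_inner"
  assumes "(\<lambda>x. (norm (f x))\<^sup>2) summable_on A" "(\<lambda>x. (norm (g x))\<^sup>2) summable_on A"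
  shows "(\<lambda>x. f x \<bullet> g x) summable_on A"
proof -
  have "(\<lambda>x. norm (f x \<bullet> g x)) summable_on A"
  proof (rule summable_on_comparison_test)
    show "(\<lambda>x. (norm (f x))\<^sup>2 + (norm (g x))\<^sup>2) summable_on A"
      by (intro summable_on_add assms)
    fix x
    have "norm (f x \<bullet> g x) \<le> norm (f x) * norm (g x)"
      by (simp add: Cauchy_Schwarz_ineq2)
    also have "\<dots> \<le> (norm (f x))\<^sup>2 + (norm (g x))\<^sup>2"
      using sum_squares_bound[of "norm (f x)" "norm (g x)"]
        mult_nonneg_nonneg[OF norm_ge_zero[of "f x"] norm_ge_zero[of "g x"]] by linarith
    finally show "norm (f x \<bullet> g x) \<le> (norm (f x))\<^sup>2 + (norm (g x))\<^sup>2" .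
  qed auto
  then show ?thesis
    by (rule abs_summable_summable)
qed

lemma square_summable_add:
  fixes f g :: "'i \<Rightarrow> 'v::real_inner"
  assumes "(\<lambda>x. (norm (f x))\<^sup>2) summable_on A" "(\<lambda>x. (norm (g x))\<^sup>2) summable_on A"
  shows "(\<lambda>x. (norm (f x + g x))\<^sup>2) summable_on A"
proof -
  have "(\<lambda>x. (norm (f x))\<^sup>2 + (norm (g x))\<^sup>2 + 2 * (f x \<bullet> g x)) summable_on A"
    by (intro summable_on_add summable_on_cmult_right square_summable_inner assms)
  moreover have "(norm (f x))\<^sup>2 + (norm (g x))\<^sup>2 + 2 * (f x \<bullet> g x) = (norm (f x + g x))\<^sup>2" for x
    unfolding power2_norm_eq_inner by (simp add: inner_add inner_commute)
  ultimately show ?thesis by simp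
qed

lemma square_summable_scale:
  fixes f :: "'i \<Rightarrow> 'v::real_normed_vector" and g :: "'i \<Rightarrow> 'w::real_normed_vector"
  assumes "(\<lambda>x. (norm (f x))\<^sup>2) summable_on A" "\<And>x. norm (g x) \<le> c * norm (f x)"
  shows "(\<lambda>x. (norm (g x))\<^sup>2) summable_on A"
proof (rule summable_on_comparison_test)
  show "(\<lambda>x. c\<^sup>2 * (norm (f x))\<^sup>2) summable_on A"
    by (intro summable_on_cmult_right assms)
  show "(norm (g x))\<^sup>2 \<le> c\<^sup>2 * (norm (f x))\<^sup>2" for x
    using power_mono[OF assms(2)[of x] norm_ge_zero, of 2] by (simp add: power_mult_distrib)
qed auto

typedef l2 = "{f :: int \<Rightarrow> complex^2. (\<lambda>x. (norm (f x))\<^sup>2) summable_on UNIV}"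
  morphisms l2_apply Abs_l2
  by (rule exI[of _ "\<lambda>_. 0"]) auto

setup_lifting type_definition_l2

lemma l2_eqI: "(\<And>x. l2_apply f x = l2_apply g x) \<Longrightarrow> f = g"
  by (simp add: l2_apply_inject[symmetric] ext)

lemma l2_summable: "(\<lambda>x. (norm (l2_apply f x))\<^sup>2) summable_on UNIV"
  using l2_apply[of f] by simp

text \<open>The real inner product below is the real part of the usual Hermitian inner product, so it
  induces the usual norm.\<close>

instantiation l2 :: real_inner
begin

lift_definition zero_l2 :: l2 is "\<lambda>_. 0" by simp
lift_definition plus_l2 :: "l2 \<Rightarrow> l2 \<Rightarrow> l2" is "\<lambda>f g x. f x + g x"
  by (rule square_summable_add)
lift_definition uminus_l2 :: "l2 \<Rightarrow> l2" is "\<lambda>f x. - f x" by simp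
lift_definition minus_l2 :: "l2 \<Rightarrow> l2 \<Rightarrow> l2" is "\<lambda>f g x. f x - g x"
  using square_summable_add[of _ UNIV "\<lambda>x. - _ x"] by simp
lift_definition scaleR_l2 :: "real \<Rightarrow> l2 \<Rightarrow> l2" is "\<lambda>r f x. r *\<^sub>R f x"
  by (erule square_summable_scale) (rule eq_refl, rule norm_scaleR)
lift_definition inner_l2 :: "l2 \<Rightarrow> l2 \<Rightarrow> real" is "\<lambda>f g. \<Sum>\<^sub>\<infinity>x. f x \<bullet> g x" .

definition norm_l2 :: "l2 \<Rightarrow> real" where "norm_l2 f = sqrt (f \<bullet> f)"
definition dist_l2 :: "l2 \<Rightarrow> l2 \<Rightarrow> real" where "dist_l2 f g = norm (f - g)"
definition sgn_l2 :: "l2 \<Rightarrow> l2" where "sgn_l2 f = inverse (norm f) *\<^sub>R f"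
definition uniformity_l2 :: "(l2 \<times> l2) filter"
  where "uniformity_l2 = (INF e\<in>{0<..}. principal {(x, y). dist x y < e})"
definition open_l2 :: "l2 set \<Rightarrow> bool"
  where "open_l2 S = (\<forall>x\<in>S. \<forall>\<^sub>F (x', y) in uniformity. x' = x \<longrightarrow> y \<in> S)"

instance
proof
  fix f g h :: l2 and r s :: real
  show "f + g + h = f + (g + h)" by transfer (simp add: add.assoc)
  show "f + g = g + f" by transfer (simp add: add.commute)
  show "0 + f = f" by transfer simp
  show "- f + f = 0" by transfer simp
  show "f - g = f + - g" by transfer simp
  show "r *\<^sub>R (f + g) = r *\<^sub>R f + r *\<^sub>R g" by transfer (simp add: scaleR_add_right)
  show "(r + s) *\<^sub>R f = r *\<^sub>R f + s *\<^sub>R f" by transfer (simp add: scaleR_add_left)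
  show "r *\<^sub>R s *\<^sub>R f = (r * s) *\<^sub>R f" by transfer simp
  show "1 *\<^sub>R f = f" by transfer simp
  show "sgn f = inverse (norm f) *\<^sub>R f" by (rule sgn_l2_def)
  show "dist f g = norm (f - g)" by (rule dist_l2_def)
  show "uniformity = (INF e\<in>{0<..}. principal {(x, y :: l2). dist x y < e})"
    by (rule uniformity_l2_def)
  show "open S = (\<forall>x\<in>S. \<forall>\<^sub>F (x', y) in uniformity. x' = x \<longrightarrow> y \<in> S)" for S :: "l2 set"
    by (rule open_l2_def)
  show "f \<bullet> g = g \<bullet> f" by transfer (simp add: inner_commute)
  show "(f + g) \<bullet> h = f \<bullet> h + g \<bullet> h"
    by transfer (simp add: inner_add_left infsum_add square_summable_inner)
  show "(r *\<^sub>R f) \<bullet> g = r * (f \<bullet> g)"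
    by transfer (simp add: infsum_cmult_right')
  show "0 \<le> f \<bullet> f" by transfer (simp add: infsum_nonneg)
  show "f \<bullet> f = 0 \<longleftrightarrow> f = 0"
  proof
    assume "f \<bullet> f = 0"
    then show "f = 0"
    proof (transfer, intro ext)
      fix f :: "int \<Rightarrow> complex^2" and x
      assume *: "(\<lambda>x. (norm (f x))\<^sup>2) summable_on UNIV" "(\<Sum>\<^sub>\<infinity>x. f x \<bullet> f x) = 0"
      have "f x \<bullet> f x = 0"
        by (rule nonneg_infsum_le_0D[of "\<lambda>x. f x \<bullet> f x" UNIV])
          (use * in \<open>auto intro: square_summable_inner\<close>)
      then show "f x = 0" by simp
    qed
  qed (transfer, simp)
  show "norm f = sqrt (f \<bullet> f)" by (rule norm_l2_def)
qed

end

lemma norm_l2_sq: "(norm f)\<^sup>2 = (\<Sum>\<^sub>\<infinity>x. (norm (l2_apply f x))\<^sup>2)"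
  by (simp add: power2_norm_eq_inner inner_l2.rep_eq)

lemma norm_l2_apply_le: "norm (l2_apply f x) \<le> norm f"
proof -
  have "(\<Sum>x\<in>{x}. (norm (l2_apply f x))\<^sup>2) \<le> (\<Sum>\<^sub>\<infinity>x. (norm (l2_apply f x))\<^sup>2)"
    by (rule finite_sum_le_infsum) (auto intro: l2_summable)
  then have "(norm (l2_apply f x))\<^sup>2 \<le> (norm f)\<^sup>2"
    by (simp add: norm_l2_sq)
  then show ?thesis by (rule power2_le_imp_le) simp
qed

lemma norm_l2_leI:
  assumes "\<And>x. norm (l2_apply f x) \<le> c * norm (l2_apply g x)" "0 \<le> c"
  shows "norm f \<le> c * norm g"
proof (rule power2_le_imp_le)
  have "(norm (l2_apply f x))\<^sup>2 \<le> c\<^sup>2 * (norm (l2_apply g x))\<^sup>2" for x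
    using power_mono[OF assms(1)[of x] norm_ge_zero, of 2] by (simp add: power_mult_distrib)
  then have "(norm f)\<^sup>2 \<le> (\<Sum>\<^sub>\<infinity>x. c\<^sup>2 * (norm (l2_apply g x))\<^sup>2)"
    unfolding norm_l2_sq by (intro infsum_mono summable_on_cmult_right l2_summable)
  then show "(norm f)\<^sup>2 \<le> (c * norm g)\<^sup>2"
    by (simp add: power_mult_distrib norm_l2_sq infsum_cmult_right')
qed (use assms in simp)

instance l2 :: banach
proof
  fix X :: "nat \<Rightarrow> l2"
  assume X: "Cauchy X"
  have "Cauchy (\<lambda>n. l2_apply (X n) x)" for x
  proof (rule metric_CauchyI)
    fix e :: real assume "e > 0"
    then obtain M where M: "\<And>m n. m \<ge> M \<Longrightarrow> n \<ge> M \<Longrightarrow> dist (X m) (X n) < e"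
      using metric_CauchyD[OF X] by blast
    have "dist (l2_apply (X m) x) (l2_apply (X n) x) \<le> dist (X m) (X n)" for m n
      using norm_l2_apply_le[of "X m - X n" x] by (simp add: dist_norm minus_l2.rep_eq)
    then show "\<exists>M. \<forall>m\<ge>M. \<forall>n\<ge>M. dist (l2_apply (X m) x) (l2_apply (X n) x) < e"
      using M by (meson order.strict_trans1)
  qed
  then have "(\<lambda>n. l2_apply (X n) x) \<longlonglongrightarrow> lim (\<lambda>n. l2_apply (X n) x)" for x
    by (simp add: Cauchy_convergent_iff convergent_LIMSEQ_iff)
  then obtain L where L: "\<And>x. (\<lambda>n. l2_apply (X n) x) \<longlonglongrightarrow> L x" ..
  have bound: "\<exists>M. \<forall>n\<ge>M. \<forall>F. finite F \<longrightarrow> (\<Sum>x\<in>F. (norm (l2_apply (X n) x - L x))\<^sup>2) \<le> e\<^sup>2"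
    if "e > 0" for e
  proof -
    obtain M where M: "\<And>m n. m \<ge> M \<Longrightarrow> n \<ge> M \<Longrightarrow> dist (X m) (X n) < e"
      using metric_CauchyD[OF X \<open>e > 0\<close>] by blast
    have "(\<Sum>x\<in>F. (norm (l2_apply (X n) x - L x))\<^sup>2) \<le> e\<^sup>2" if "n \<ge> M" "finite F" for n F
    proof (rule LIMSEQ_le_const2)
      show "(\<lambda>m. \<Sum>x\<in>F. (norm (l2_apply (X n) x - l2_apply (X m) x))\<^sup>2)
              \<longlonglongrightarrow> (\<Sum>x\<in>F. (norm (l2_apply (X n) x - L x))\<^sup>2)"
        by (intro tendsto_intros L)
      have "(\<Sum>x\<in>F. (norm (l2_apply (X n) x - l2_apply (X m) x))\<^sup>2) \<le> e\<^sup>2" if "m \<ge> M" for m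
      proof -
        have "(\<Sum>x\<in>F. (norm (l2_apply (X n - X m) x))\<^sup>2) \<le> (norm (X n - X m))\<^sup>2"
          unfolding norm_l2_sq by (rule finite_sum_le_infsum) (use \<open>finite F\<close> in \<open>auto intro: l2_summable\<close>)
        also have "\<dots> \<le> e\<^sup>2"
          using M[OF \<open>n \<ge> M\<close> \<open>m \<ge> M\<close>] by (intro power_mono) (auto simp: dist_norm)
        finally show ?thesis by (simp add: minus_l2.rep_eq)
      qed
      then show "\<exists>N. \<forall>m\<ge>N. (\<Sum>x\<in>F. (norm (l2_apply (X n) x - l2_apply (X m) x))\<^sup>2) \<le> e\<^sup>2"
        by blast
    qed
    then show ?thesis by blast
  qed
  have summ: "(\<lambda>x. (norm (l2_apply (X n) x - L x))\<^sup>2) summable_on UNIV"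
    if "\<forall>F. finite F \<longrightarrow> (\<Sum>x\<in>F. (norm (l2_apply (X n) x - L x))\<^sup>2) \<le> e\<^sup>2" for n e
    by (rule nonneg_bdd_above_summable_on) (use that in \<open>auto intro!: bdd_aboveI[of _ "e\<^sup>2"]\<close>)
  obtain M where M: "\<forall>F. finite F \<longrightarrow> (\<Sum>x\<in>F. (norm (l2_apply (X M) x - L x))\<^sup>2) \<le> 1\<^sup>2"
    using bound[of 1] by auto
  have "(\<lambda>x. (norm (l2_apply (X M) x + (L x - l2_apply (X M) x)))\<^sup>2) summable_on UNIV"
    by (rule square_summable_add) (use l2_summable summ[OF M] in \<open>simp_all add: norm_minus_commute\<close>)
  then have L_l2: "(\<lambda>x. (norm (L x))\<^sup>2) summable_on UNIV" by simp
  define l where "l = Abs_l2 L"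
  have l: "l2_apply l = L" unfolding l_def using L_l2 by (simp add: Abs_l2_inverse)
  have "X \<longlonglongrightarrow> l"
  proof (rule metric_LIMSEQ_I)
    fix e :: real assume "e > 0"
    then obtain M where M: "\<forall>n\<ge>M. \<forall>F. finite F \<longrightarrow>
        (\<Sum>x\<in>F. (norm (l2_apply (X n) x - L x))\<^sup>2) \<le> (e/2)\<^sup>2"
      using bound[of "e/2"] by auto
    have "dist (X n) l < e" if "n \<ge> M" for n
    proof -
      have *: "\<forall>F. finite F \<longrightarrow> (\<Sum>x\<in>F. (norm (l2_apply (X n) x - L x))\<^sup>2) \<le> (e/2)\<^sup>2"
        using M that by blast
      have "(norm (X n - l))\<^sup>2 \<le> (e/2)\<^sup>2"
        unfolding norm_l2_sq minus_l2.rep_eq l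
        by (rule infsum_le_finite_sums) (use summ[OF *] * in auto)
      then have "norm (X n - l) \<le> e/2"
        by (rule power2_le_imp_le) (use \<open>e > 0\<close> in simp)
      then show ?thesis using \<open>e > 0\<close> by (simp add: dist_norm)
    qed
    then show "\<exists>M. \<forall>n\<ge>M. dist (X n) l < e" by blast
  qed
  then show "convergent X" by (auto simp: convergent_def)
qed

lift_definition l2_scaleC :: "complex \<Rightarrow> l2 \<Rightarrow> l2" is "\<lambda>c f x. c *s f x"
proof -
  fix c :: complex and f :: "int \<Rightarrow> complex^2"
  have *: "norm (c *s v) \<le> cmod c * norm v" for v :: "complex^2"
    by (simp add: norm_vec_def norm_mult L2_set_right_distrib)
  show "(\<lambda>x. (norm (c *s f x))\<^sup>2) summable_on UNIV" if "(\<lambda>x. (norm (f x))\<^sup>2) summable_on UNIV"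
    by (rule square_summable_scale[OF that *])
qed

lemma bounded_linear_l2_scaleC: "bounded_linear (l2_scaleC c)"
proof (rule bounded_linear_intro)
  show "l2_scaleC c (f + g) = l2_scaleC c f + l2_scaleC c g" for f g
    by transfer (simp add: vector_add_ldistrib)
  show "l2_scaleC c (r *\<^sub>R f) = r *\<^sub>R l2_scaleC c f" for r f
    by transfer (simp add: vec_eq_iff fun_eq_iff)
  show "norm (l2_scaleC c f) \<le> norm f * cmod c" for f
    unfolding mult.commute[of "norm f"]
    by (rule norm_l2_leI)
      (simp_all add: l2_scaleC.rep_eq norm_vec_def norm_mult L2_set_right_distrib)
qed

section \<open>The Banach algebra of bounded operators\<close>

typedef l2op = "{A :: l2 \<Rightarrow>\<^sub>L l2. \<forall>c f. A (l2_scaleC c f) = l2_scaleC c (A f)}"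
  morphisms l2op_blinfun Abs_l2op
  by (rule exI[of _ 0]) (auto simp: linear_0 bounded_linear.linear[OF bounded_linear_l2_scaleC])

setup_lifting type_definition_l2op

lemma l2_scaleC_linear:
  "l2_scaleC c 0 = 0" "l2_scaleC c (f + g) = l2_scaleC c f + l2_scaleC c g"
  "l2_scaleC c (f - g) = l2_scaleC c f - l2_scaleC c g" "l2_scaleC c (- f) = - l2_scaleC c f"
  "l2_scaleC c (r *\<^sub>R f) = r *\<^sub>R l2_scaleC c f"
  using bounded_linear.linear[OF bounded_linear_l2_scaleC]
  by (simp_all add: linear_0 linear_add linear_diff linear_neg linear_scale)

lemma l2_scaleC_mult: "l2_scaleC c (l2_scaleC d f) = l2_scaleC (c * d) f"
  by transfer (simp add: vec_eq_iff)

definition l2op_apply :: "l2op \<Rightarrow> l2 \<Rightarrow> l2"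
  where "l2op_apply A = blinfun_apply (l2op_blinfun A)"

lemma l2op_eqI: "(\<And>f. l2op_apply A f = l2op_apply B f) \<Longrightarrow> A = B"
  unfolding l2op_apply_def by (simp add: l2op_blinfun_inject[symmetric] blinfun_eqI)

text \<open>Multiplication is composition and the norm is the operator norm, so that \<^const>\<open>exp\<close> is the
  norm convergent exponential series of a bounded operator.\<close>

instantiation l2op :: real_normed_algebra_1
begin

lift_definition zero_l2op :: l2op is 0
  by (simp add: l2_scaleC_linear)
lift_definition one_l2op :: l2op is id_blinfun
  by simp
lift_definition plus_l2op :: "l2op \<Rightarrow> l2op \<Rightarrow> l2op" is "(+)"
  by (simp add: l2_scaleC_linear plus_blinfun.rep_eq)
lift_definition uminus_l2op :: "l2op \<Rightarrow> l2op" is uminus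
  by (simp add: l2_scaleC_linear uminus_blinfun.rep_eq)
lift_definition minus_l2op :: "l2op \<Rightarrow> l2op \<Rightarrow> l2op" is "(-)"
  by (simp add: l2_scaleC_linear minus_blinfun.rep_eq)
lift_definition times_l2op :: "l2op \<Rightarrow> l2op \<Rightarrow> l2op" is "(o\<^sub>L)"
  by simp
lift_definition scaleR_l2op :: "real \<Rightarrow> l2op \<Rightarrow> l2op" is "(*\<^sub>R)"
  by (simp add: l2_scaleC_linear scaleR_blinfun.rep_eq)
lift_definition norm_l2op :: "l2op \<Rightarrow> real" is norm .

definition dist_l2op :: "l2op \<Rightarrow> l2op \<Rightarrow> real" where "dist_l2op A B = norm (A - B)"
definition sgn_l2op :: "l2op \<Rightarrow> l2op" where "sgn_l2op A = inverse (norm A) *\<^sub>R A"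
definition uniformity_l2op :: "(l2op \<times> l2op) filter"
  where "uniformity_l2op = (INF e\<in>{0<..}. principal {(x, y). dist x y < e})"
definition open_l2op :: "l2op set \<Rightarrow> bool"
  where "open_l2op S = (\<forall>x\<in>S. \<forall>\<^sub>F (x', y) in uniformity. x' = x \<longrightarrow> y \<in> S)"

instance
proof
  obtain f :: l2 where f: "f \<noteq> 0"
  proof
    have fin: "finite {x::int. x = 0}" by simp
    have "(\<lambda>x::int. (norm (if x = 0 then axis 1 1 else 0 :: complex^2))\<^sup>2) summable_on UNIV"
      by (rule finite_nonzero_values_imp_summable_on) (rule finite_subset[OF _ fin], auto)
    then have "l2_apply (Abs_l2 (\<lambda>x. if x = 0 then axis 1 1 else 0)) 0 = axis 1 1"
      by (simp add: Abs_l2_inverse)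
    then show "Abs_l2 (\<lambda>x. if x = 0 then axis 1 1 else 0) \<noteq> 0"
      by (metis axis_eq_0_iff zero_l2.rep_eq zero_neq_one)
  qed
  fix A B C :: l2op and r s :: real
  show "A + B + C = A + (B + C)" by transfer (simp add: add.assoc)
  show "A + B = B + A" by transfer (simp add: add.commute)
  show "0 + A = A" by transfer simp
  show "- A + A = 0" by transfer simp
  show "A - B = A + - B" by transfer simp
  show "r *\<^sub>R (A + B) = r *\<^sub>R A + r *\<^sub>R B" by transfer (simp add: scaleR_add_right)
  show "(r + s) *\<^sub>R A = r *\<^sub>R A + s *\<^sub>R A" by transfer (simp add: scaleR_add_left)
  show "r *\<^sub>R s *\<^sub>R A = (r * s) *\<^sub>R A" by transfer simp
  show "1 *\<^sub>R A = A" by transfer simp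
  show "A * B * C = A * (B * C)" by transfer (auto intro: blinfun_eqI)
  show "1 * A = A" by transfer (auto intro: blinfun_eqI)
  show "A * 1 = A" by transfer (auto intro: blinfun_eqI)
  show "(A + B) * C = A * C + B * C"
    by transfer (auto intro: blinfun_eqI simp: plus_blinfun.rep_eq)
  show "A * (B + C) = A * B + A * C"
    by transfer (auto intro: blinfun_eqI simp: plus_blinfun.rep_eq blinfun.add_right)
  show "r *\<^sub>R A * B = r *\<^sub>R (A * B)"
    by transfer (auto intro: blinfun_eqI simp: scaleR_blinfun.rep_eq)
  show "A * r *\<^sub>R B = r *\<^sub>R (A * B)"
    by transfer (auto intro: blinfun_eqI simp: scaleR_blinfun.rep_eq blinfun.scaleR_right)
  show "(0::l2op) \<noteq> 1"
  proof
    assume "(0::l2op) = 1"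
    then have "blinfun_apply (l2op_blinfun 0) f = blinfun_apply (l2op_blinfun 1) f"
      by (rule arg_cong)
    then show False using f by (simp add: zero_l2op.rep_eq one_l2op.rep_eq)
  qed
  show "norm (1::l2op) = 1"
  proof (transfer, rule norm_blinfun_eqI)
    show "1 \<le> norm (blinfun_apply id_blinfun f) / norm f" using f by simp
  qed simp_all
  show "norm (A * B) \<le> norm A * norm B" by transfer (rule norm_blinfun_compose)
  show "norm A = 0 \<longleftrightarrow> A = 0" by transfer simp
  show "norm (A + B) \<le> norm A + norm B" by transfer (rule norm_triangle_ineq)
  show "norm (r *\<^sub>R A) = \<bar>r\<bar> * norm A" by transfer simp
  show "sgn A = inverse (norm A) *\<^sub>R A" by (rule sgn_l2op_def)
  show "dist A B = norm (A - B)" by (rule dist_l2op_def)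
  show "uniformity = (INF e\<in>{0<..}. principal {(x, y :: l2op). dist x y < e})"
    by (rule uniformity_l2op_def)
  show "open S = (\<forall>x\<in>S. \<forall>\<^sub>F (x', y) in uniformity. x' = x \<longrightarrow> y \<in> S)" for S :: "l2op set"
    by (rule open_l2op_def)
qed

end

instance l2op :: banach
proof
  fix X :: "nat \<Rightarrow> l2op"
  assume X: "Cauchy X"
  have dist_eq: "dist (l2op_blinfun A) (l2op_blinfun B) = dist A B" for A B
    unfolding dist_norm by transfer simp
  have "Cauchy (\<lambda>n. l2op_blinfun (X n))"
    using X unfolding Cauchy_def dist_eq .
  then obtain L where L: "(\<lambda>n. l2op_blinfun (X n)) \<longlonglongrightarrow> L"
    by (metis Cauchy_convergent_iff convergent_def)
  have app: "(\<lambda>n. blinfun_apply (l2op_blinfun (X n)) f) \<longlonglongrightarrow> blinfun_apply L f" for f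
    by (intro tendsto_intros L)
  have "blinfun_apply L (l2_scaleC c f) = l2_scaleC c (blinfun_apply L f)" for c f
  proof (rule LIMSEQ_unique)
    show "(\<lambda>n. blinfun_apply (l2op_blinfun (X n)) (l2_scaleC c f))
            \<longlonglongrightarrow> blinfun_apply L (l2_scaleC c f)" by (rule app)
    have "blinfun_apply (l2op_blinfun A) (l2_scaleC c f)
        = l2_scaleC c (blinfun_apply (l2op_blinfun A) f)" for A
      using l2op_blinfun[of A] by simp
    then show "(\<lambda>n. blinfun_apply (l2op_blinfun (X n)) (l2_scaleC c f))
            \<longlonglongrightarrow> l2_scaleC c (blinfun_apply L f)"
      by (simp add: bounded_linear.tendsto[OF bounded_linear_l2_scaleC app])
  qed
  then have l: "l2op_blinfun (Abs_l2op L) = L" by (simp add: Abs_l2op_inverse)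
  have "X \<longlonglongrightarrow> Abs_l2op L"
    using L unfolding lim_sequentially by (simp add: dist_eq[symmetric] l)
  then show "convergent X" by (auto simp: convergent_def)
qed

lift_definition l2op_scaleC :: "complex \<Rightarrow> l2op \<Rightarrow> l2op" (infixr "*\<^sub>C" 75)
  is "\<lambda>c A. Blinfun (l2_scaleC c) o\<^sub>L A"
proof -
  fix c d :: complex and A :: "l2 \<Rightarrow>\<^sub>L l2" and f
  assume "\<And>c f. blinfun_apply A (l2_scaleC c f) = l2_scaleC c (blinfun_apply A f)"
  then show "blinfun_apply (Blinfun (l2_scaleC c) o\<^sub>L A) (l2_scaleC d f)
      = l2_scaleC d (blinfun_apply (Blinfun (l2_scaleC c) o\<^sub>L A) f)"
    by (simp add: bounded_linear_Blinfun_apply[OF bounded_linear_l2_scaleC] l2_scaleC_mult mult.commute)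
qed

lemma l2op_apply_simps:
  "l2op_apply 0 f = 0" "l2op_apply 1 f = f" "l2op_apply (- A) f = - l2op_apply A f"
  "l2op_apply (A + B) f = l2op_apply A f + l2op_apply B f"
  "l2op_apply (A - B) f = l2op_apply A f - l2op_apply B f"
  "l2op_apply (r *\<^sub>R A) f = r *\<^sub>R l2op_apply A f"
  "l2op_apply (c *\<^sub>C A) f = l2_scaleC c (l2op_apply A f)"
  "l2op_apply (A * B) f = l2op_apply A (l2op_apply B f)"
  unfolding l2op_apply_def
  by (simp_all add: zero_l2op.rep_eq one_l2op.rep_eq uminus_l2op.rep_eq plus_l2op.rep_eq
      minus_l2op.rep_eq scaleR_l2op.rep_eq l2op_scaleC.rep_eq times_l2op.rep_eq
      uminus_blinfun.rep_eq plus_blinfun.rep_eq minus_blinfun.rep_eq scaleR_blinfun.rep_eq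
      bounded_linear_Blinfun_apply[OF bounded_linear_l2_scaleC])

section \<open>Shifts and matrix operators\<close>

lemma bij_int_shift: "bij (\<lambda>x. x - y :: int)"
  by (rule bijI') (auto intro: exI[of _ "_ + y"])

lift_definition l2_shift :: "int \<Rightarrow> l2 \<Rightarrow> l2" is "\<lambda>y f x. f (x - y)"
  by (rule summable_on_reindex_bij_betw[OF bij_int_shift, THEN iffD2])

lemma norm_l2_shift: "norm (l2_shift y f) = norm f"
  unfolding norm_eq_sqrt_inner inner_l2.rep_eq l2_shift.rep_eq
  using infsum_reindex_bij_betw[OF bij_int_shift, of "\<lambda>x. l2_apply f x \<bullet> l2_apply f x" y] by simp

lift_definition l2_matrix :: "complex^2^2 \<Rightarrow> l2 \<Rightarrow> l2" is "\<lambda>M f x. M *v f x"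
proof -
  fix M :: "complex^2^2" and f :: "int \<Rightarrow> complex^2"
  have *: "norm (M *v v) \<le> onorm ((*v) M) * norm v" for v
    by (simp add: onorm matrix_vector_mul_bounded_linear)
  show "(\<lambda>x. (norm (M *v f x))\<^sup>2) summable_on UNIV" if "(\<lambda>x. (norm (f x))\<^sup>2) summable_on UNIV"
    by (rule square_summable_scale[OF that *])
qed

lemma bounded_linear_l2_shift: "bounded_linear (l2_shift y)"
proof (rule bounded_linear_intro[where K = 1])
  show "l2_shift y (f + g) = l2_shift y f + l2_shift y g" for f g by transfer simp
  show "l2_shift y (r *\<^sub>R f) = r *\<^sub>R l2_shift y f" for r f by transfer simp
qed (simp add: norm_l2_shift)

lemma bounded_linear_l2_matrix: "bounded_linear (l2_matrix M)"
proof (rule bounded_linear_intro)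
  show "l2_matrix M (f + g) = l2_matrix M f + l2_matrix M g" for f g
    by transfer (simp add: matrix_vector_right_distrib)
  show "l2_matrix M (r *\<^sub>R f) = r *\<^sub>R l2_matrix M f" for r f
    by transfer (simp add: linear_scale bounded_linear.linear matrix_vector_mul_bounded_linear)
  show "norm (l2_matrix M f) \<le> norm f * onorm ((*v) M)" for f
    unfolding mult.commute[of "norm f"]
    by (rule norm_l2_leI)
      (simp_all add: l2_matrix.rep_eq onorm onorm_pos_le matrix_vector_mul_bounded_linear)
qed

lemma l2_shift_scaleC: "l2_shift y (l2_scaleC c f) = l2_scaleC c (l2_shift y f)"
  by (rule l2_eqI) (simp add: l2_shift.rep_eq l2_scaleC.rep_eq)

lemma l2_matrix_scaleC: "l2_matrix M (l2_scaleC c f) = l2_scaleC c (l2_matrix M f)"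
  by (rule l2_eqI) (simp add: l2_matrix.rep_eq l2_scaleC.rep_eq vector_scalar_commute)

text \<open>\<open>shift y\<close> is the power \<open>\<tau>\<^sup>y\<close> of the shift \<open>\<tau> = shift 1\<close>, for every integer \<open>y\<close>:
  see \<open>shift_0\<close> and \<open>shift_add\<close> below.\<close>

lift_definition shift :: "int \<Rightarrow> l2op" is "\<lambda>y. Blinfun (l2_shift y)"
  unfolding bounded_linear_Blinfun_apply[OF bounded_linear_l2_shift] by (rule l2_shift_scaleC)

lift_definition matrix_op :: "complex^2^2 \<Rightarrow> l2op" is "\<lambda>M. Blinfun (l2_matrix M)"
  unfolding bounded_linear_Blinfun_apply[OF bounded_linear_l2_matrix]
  by (rule l2_matrix_scaleC)

lemma shift_apply: "l2_apply (l2op_apply (shift y) f) x = l2_apply f (x - y)"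
  unfolding l2op_apply_def shift.rep_eq
  by (simp add: bounded_linear_Blinfun_apply[OF bounded_linear_l2_shift] l2_shift.rep_eq)

lemma matrix_op_apply: "l2_apply (l2op_apply (matrix_op M) f) x = M *v l2_apply f x"
  unfolding l2op_apply_def matrix_op.rep_eq
  by (simp add: bounded_linear_Blinfun_apply[OF bounded_linear_l2_matrix] l2_matrix.rep_eq)

lemma shift_0: "shift 0 = 1"
  by (intro l2op_eqI l2_eqI) (simp add: shift_apply l2op_apply_simps)

lemma shift_add: "shift (y + z) = shift y * shift z"
  by (intro l2op_eqI l2_eqI) (simp add: shift_apply l2op_apply_simps algebra_simps)

section \<open>The quantum walk and its logarithm\<close>

definition proj :: "2 \<Rightarrow> complex^2^2"
  where "proj i = (\<chi> j k. if j = i \<and> k = i then 1 else 0)"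

lemma proj_apply: "proj i *v v = axis i (v $ i)"
  by (auto simp: proj_def matrix_vector_mult_def axis_def vec_eq_iff if_distrib[of "\<lambda>c. c * _"] cong: if_cong)

definition quantum_walk :: "complex^2^2 \<Rightarrow> l2op"
  where "quantum_walk T =
    matrix_op T * matrix_op (proj 1) * shift 1 + matrix_op T * matrix_op (proj 2) * shift (- 1)"

definition phase :: "real \<Rightarrow> real \<Rightarrow> real"
  where "phase s \<theta> = arccos (s * cos \<theta>)"

definition I_coeff :: "real \<Rightarrow> int \<Rightarrow> complex"
  where "I_coeff s x = 1 / (2 * pi) * integral {0..2 * pi}
    (\<lambda>\<theta>. exp (- \<i> * of_int x * of_real \<theta>) * of_real (sin \<theta> * (phase s \<theta> / sin (phase s \<theta>))))"

definition J_coeff :: "real \<Rightarrow> int \<Rightarrow> complex"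
  where "J_coeff s x = 1 / (2 * pi) * integral {0..2 * pi}
    (\<lambda>\<theta>. exp (- \<i> * of_int x * of_real \<theta>) * of_real (phase s \<theta> / sin (phase s \<theta>)))"

definition D_coeff :: "complex^2^2 \<Rightarrow> int \<Rightarrow> complex^2^2"
  where "D_coeff T x =
    (let a = T $ 1 $ 1; b = T $ 1 $ 2;
         s = cmod a; r = cmod b; \<alpha> = a / of_real s; \<beta> = b / of_real r
     in vector [vector [s * \<alpha> powi x * I_coeff s x,
                        - \<i> * r * \<alpha> powi (x + 1) * \<beta> * J_coeff s (x + 1)],
                vector [\<i> * r * \<alpha> powi (x - 1) * inverse \<beta> * J_coeff s (x - 1),
                        - s * \<alpha> powi x * I_coeff s x]])"

text \<open>The sum is taken in operator norm.\<close>

definition D_op :: "complex^2^2 \<Rightarrow> l2op"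
  where "D_op T = (\<Sum>\<^sub>\<infinity>y. matrix_op (D_coeff T y) * shift y)"

end

theory Submission
  imports Defs "HOL-Complex_Analysis.Cauchy_Integral_Formula"
begin

text \<open>Under the Fourier transform both sides become multiplication by a continuous loop of
  \<open>2 \<times> 2\<close> matrices, and the theorem reduces to the elementary fact that a special unitary matrix \<open>u\<close> with
  trace \<open>2 cos \<phi>\<close>, \<open>0 < \<phi> < \<pi>\<close>, can be written as \<open>u = cos \<phi> + i sin \<phi> V = exp (i \<phi> V)\<close> with
  \<open>V\<^sup>2 = 1\<close>. Let \<open>z\<close> be the symbol of \<open>\<tau>\<close>, normalised so that \<open>\<alpha> z = e\<^sup>i\<^sup>\<theta>\<close>. The symbol
  of \<open>U(T)\<close> has determinant 1 and trace \<open>2 s cos \<theta>\<close>, whence \<open>\<phi> = arccos (s cos \<theta>)\<close>, and \<open>\<phi> V\<close> is \<open>\<phi> / sin \<phi>\<close>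
  times an explicit matrix whose entries are linear in \<open>sin \<theta>\<close>, \<open>z\<close> and \<open>1 / z\<close>. Its
  coefficients with respect to the powers \<open>z\<^sup>y\<close> are the matrices \<open>\<D>\<^sub>T(y)\<close>, so \<open>\<phi> V\<close> is the symbol of \<open>D(T)\<close>.

  Instead of a Fourier transform as a unitary map, the proof uses the relation \<open>has_symbol\<close>: an operator
  \<open>B\<close> has symbol \<open>M\<close> if, up to a gauge, it sends the sequence of Fourier coefficients of every continuous \<open>F\<close>
  to that of \<open>M F\<close>. The relation is closed under sums, products and limits that are taken in operator
  norm and uniformly (\<open>has_symbol_uniform_limit\<close>), and the symbol determines the operator
  (\<open>has_symbol_unique\<close>). The exponential series therefore carries over to symbols
  (\<open>has_symbol_exp\<close>).

  The analytic point is that the series for \<open>D(T)\<close> converges in operator norm and has the expected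
  symbol, that is, that \<open>\<phi> / sin \<phi>\<close> has an absolutely convergent Fourier series. As
  \<open>s < 1\<close>, it is a power series in \<open>s cos \<theta>\<close> taken strictly inside its disc of convergence, while \<open>(s cos \<theta>)\<^sup>n\<close>
  has absolute coefficient sum at most \<open>s\<^sup>n\<close> (\<open>absolute_fourier_phase\<close>).\<close>

section \<open>Fourier coefficients\<close>

definition fourier_coeff :: "(real \<Rightarrow> complex) \<Rightarrow> int \<Rightarrow> complex"
  where "fourier_coeff g x =
    1 / (2 * pi) * integral {0..2 * pi} (\<lambda>\<theta>. exp (- \<i> * of_int x * of_real \<theta>) * g \<theta>)"

lemma fourier_integrable:
  assumes "continuous_on {0..2 * pi} g"
  shows "(\<lambda>\<theta>. exp (- \<i> * of_int x * of_real \<theta>) * g \<theta>) integrable_on {0..2 * pi}"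
  by (intro integrable_continuous_interval continuous_intros assms)

lemma fourier_coeff_add:
  assumes "continuous_on {0..2 * pi} g" "continuous_on {0..2 * pi} h"
  shows "fourier_coeff (\<lambda>\<theta>. g \<theta> + h \<theta>) x = fourier_coeff g x + fourier_coeff h x"
  unfolding fourier_coeff_def
  by (simp only: distrib_left integral_add[OF fourier_integrable fourier_integrable] assms)

lemma fourier_coeff_cmult: "fourier_coeff (\<lambda>\<theta>. c * g \<theta>) x = c * fourier_coeff g x"
proof -
  have "exp (- \<i> * of_int x * of_real \<theta>) * (c * g \<theta>) = c * (exp (- \<i> * of_int x * of_real \<theta>) * g \<theta>)" for \<theta>
    by (rule mult.left_commute)
  then show ?thesis unfolding fourier_coeff_def by (simp only: integral_mult_right mult.left_commute)
qed

lemma fourier_coeff_translate: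
  "fourier_coeff (\<lambda>\<theta>. exp (\<i> * of_int y * of_real \<theta>) * g \<theta>) x = fourier_coeff g (x - y)"
proof -
  have "exp (- \<i> * of_int x * of_real \<theta>) * (exp (\<i> * of_int y * of_real \<theta>) * g \<theta>)
      = exp (- \<i> * of_int (x - y) * of_real \<theta>) * g \<theta>" for \<theta>
    unfolding mult.assoc[symmetric] exp_add[symmetric] by (simp add: algebra_simps)
  then show ?thesis unfolding fourier_coeff_def by (simp only:)
qed

lemma fourier_coeff_tendsto:
  assumes "uniform_limit {0..2 * pi} g h N" "\<And>n. continuous_on {0..2 * pi} (g n)" "N \<noteq> bot"
  shows "((\<lambda>n. fourier_coeff (g n) x) \<longlongrightarrow> fourier_coeff h x) N"
proof -
  have "uniform_limit {0..2 * pi} (\<lambda>n \<theta>. exp (- \<i> * of_int x * of_real \<theta>) * g n \<theta>)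
      (\<lambda>\<theta>. exp (- \<i> * of_int x * of_real \<theta>) * h \<theta>) N"
  proof (rule uniform_limitI)
    fix e :: real assume "e > 0"
    from uniform_limitD[OF assms(1) this]
    show "\<forall>\<^sub>F n in N. \<forall>\<theta>\<in>{0..2 * pi}. dist (exp (- \<i> * of_int x * of_real \<theta>) * g n \<theta>)
        (exp (- \<i> * of_int x * of_real \<theta>) * h \<theta>) < e"
      by (simp add: dist_norm right_diff_distrib[symmetric] norm_mult)
  qed
  then obtain I J where IJ:
    "\<And>n. ((\<lambda>\<theta>. exp (- \<i> * of_int x * of_real \<theta>) * g n \<theta>) has_integral I n) {0..2 * pi}"
    "((\<lambda>\<theta>. exp (- \<i> * of_int x * of_real \<theta>) * h \<theta>) has_integral J) {0..2 * pi}"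
    "(I \<longlongrightarrow> J) N"
    by (rule uniform_limit_integral) (use assms in \<open>auto intro!: continuous_intros\<close>)
  show ?thesis
    unfolding fourier_coeff_def IJ(1)[THEN integral_unique] IJ(2)[THEN integral_unique]
    by (rule tendsto_mult_left) (rule IJ(3))
qed

lemma integral_exp_int:
  assumes "x \<noteq> 0"
  shows "integral {0..2 * pi} (\<lambda>\<theta>. exp (- \<i> * complex_of_int x * of_real \<theta>)) = 0"
proof -
  define c where "c = - \<i> * complex_of_int x"
  have c: "c \<noteq> 0" using assms by (simp add: c_def)
  have "((\<lambda>\<theta>. exp (c * of_real \<theta>)) has_integral
      exp (c * of_real (2 * pi)) / c - exp (c * of_real 0) / c) {0..2 * pi}"
  proof (rule fundamental_theorem_of_calculus)
    fix \<theta> :: real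
    have "((\<lambda>w. exp (c * w) / c) has_field_derivative exp (c * \<theta>)) (at (of_real \<theta>))"
      using c by - (rule derivative_eq_intros refl | simp)+
    then show "((\<lambda>\<theta>. exp (c * of_real \<theta>) / c) has_vector_derivative exp (c * \<theta>)) (at \<theta> within {0..2 * pi})"
      by (rule has_vector_derivative_real_field[OF has_field_derivative_at_within])
  qed simp
  then have 1: "integral {0..2 * pi} (\<lambda>\<theta>. exp (c * of_real \<theta>))
      = exp (c * of_real (2 * pi)) / c - exp (c * of_real 0) / c"
    by (rule integral_unique)
  have 2: "c * of_real (2 * pi) = (2 * of_int (- x) * pi) * \<i>"
    unfolding c_def by simp
  have 3: "exp (c * of_real (2 * pi)) = 1"
    unfolding 2 by (rule exp_integer_2pi) simp
  have "integral {0..2 * pi} (\<lambda>\<theta>. exp (c * of_real \<theta>)) = 0"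
    unfolding 1 3 by simp
  then show ?thesis unfolding c_def .
qed

lemma fourier_coeff_one: "fourier_coeff (\<lambda>_. 1) x = (if x = 0 then 1 else 0)"
proof (cases "x = 0")
  case True
  have i: "integral {0..2 * pi} (\<lambda>_. 1::complex) = of_real (2 * pi)"
    by (simp add: scaleR_conv_of_real)
  have "fourier_coeff (\<lambda>_. 1) x = 1 / (2 * pi) * integral {0..2 * pi} (\<lambda>_. 1::complex)"
    unfolding fourier_coeff_def True
    by (simp only: of_int_0 mult_zero_left mult_zero_right exp_zero mult_1_right)
  also have "\<dots> = 1"
    unfolding i of_real_mult[symmetric] by simp
  finally show ?thesis by (subst if_P[OF True])
next
  case False
  have "fourier_coeff (\<lambda>_. 1) x
      = 1 / (2 * pi) * integral {0..2 * pi} (\<lambda>\<theta>. exp (- \<i> * complex_of_int x * of_real \<theta>))"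
    unfolding fourier_coeff_def by (simp only: mult_1_right)
  also have "\<dots> = 0"
    unfolding integral_exp_int[OF False] by (rule mult_zero_right)
  finally show ?thesis by (subst if_not_P[OF False])
qed

section \<open>Operators with a symbol\<close>

text \<open>The sequence \<open>f\<close> is obtained from the loop \<open>F\<close> by taking Fourier coefficients and then
  applying the gauge \<open>x \<mapsto> \<alpha>\<^sup>x\<close>. The gauge absorbs the phase of the coin entry \<open>a\<close>: the
  trace of the symbol of the walk becomes \<open>2 s cos \<theta>\<close>, and no integral ever has to be translated by
  the argument of \<open>a\<close>.\<close>

definition represents :: "complex \<Rightarrow> (real \<Rightarrow> complex^2) \<Rightarrow> l2 \<Rightarrow> bool"
  where "represents \<alpha> F f \<longleftrightarrow> continuous_on {0..2 * pi} F \<and>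
    (\<forall>x i. l2_apply f x $ i = \<alpha> powi x * fourier_coeff (\<lambda>\<theta>. F \<theta> $ i) x)"

text \<open>Quantifying over all represented sequences, rather than over finitely supported ones only, is what
  makes the relation stable under composition: the image of a represented sequence is again
  represented. Continuous \<open>F\<close> suffice to determine \<open>B\<close>, because the representatives of point masses are
  trigonometric monomials.\<close>

definition has_symbol :: "complex \<Rightarrow> l2op \<Rightarrow> (real \<Rightarrow> complex^2^2) \<Rightarrow> bool"
  where "has_symbol \<alpha> B M \<longleftrightarrow>
    (\<forall>F f. represents \<alpha> F f \<longrightarrow> represents \<alpha> (\<lambda>\<theta>. M \<theta> *v F \<theta>) (l2op_apply B f))"

lemma has_symbolD: "has_symbol \<alpha> B M \<Longrightarrow> represents \<alpha> F f \<Longrightarrow>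
    represents \<alpha> (\<lambda>\<theta>. M \<theta> *v F \<theta>) (l2op_apply B f)"
  by (simp add: has_symbol_def)

lemma has_symbol_add:
  assumes "has_symbol \<alpha> A M" "has_symbol \<alpha> B N"
  shows "has_symbol \<alpha> (A + B) (\<lambda>\<theta>. M \<theta> + N \<theta>)"
  unfolding has_symbol_def
proof (intro allI impI)
  fix F f assume F: "represents \<alpha> F f"
  note * = has_symbolD[OF assms(1) F, unfolded represents_def]
    has_symbolD[OF assms(2) F, unfolded represents_def]
  have "continuous_on {0..2 * pi} (\<lambda>\<theta>. (M \<theta> *v F \<theta>) $ i)"
    "continuous_on {0..2 * pi} (\<lambda>\<theta>. (N \<theta> *v F \<theta>) $ i)" for i
    using * by (auto intro!: continuous_intros)
  with * show "represents \<alpha> (\<lambda>\<theta>. (M \<theta> + N \<theta>) *v F \<theta>) (l2op_apply (A + B) f)"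
    unfolding represents_def matrix_vector_mult_add_rdistrib l2op_apply_simps plus_l2.rep_eq
    by (auto intro!: continuous_intros simp: fourier_coeff_add distrib_left)
qed

lemma has_symbol_mult:
  assumes "has_symbol \<alpha> A M" "has_symbol \<alpha> B N"
  shows "has_symbol \<alpha> (A * B) (\<lambda>\<theta>. M \<theta> ** N \<theta>)"
  unfolding has_symbol_def l2op_apply_simps matrix_vector_mul_assoc[symmetric]
  by (intro allI impI has_symbolD[OF assms(1)] has_symbolD[OF assms(2)])

lemma has_symbol_zero: "has_symbol \<alpha> 0 (\<lambda>_. 0)"
  by (simp add: has_symbol_def represents_def l2op_apply_simps zero_l2.rep_eq fourier_coeff_def)

lemma has_symbol_sum:
  assumes "\<And>k. k \<in> K \<Longrightarrow> has_symbol \<alpha> (A k) (M k)"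
  shows "has_symbol \<alpha> (\<Sum>k\<in>K. A k) (\<lambda>\<theta>. \<Sum>k\<in>K. M k \<theta>)"
  using assms by (induction K rule: infinite_finite_induct) (simp_all add: has_symbol_zero has_symbol_add)

lemma continuous_on_matrix_vector:
  fixes F :: "real \<Rightarrow> complex^2"
  assumes "continuous_on S F"
  shows "continuous_on S (\<lambda>\<theta>. M *v F \<theta>)"
  unfolding matrix_vector_mult_def by (intro continuous_intros assms)

lemma has_symbol_matrix: "has_symbol \<alpha> (matrix_op M) (\<lambda>_. M)"
  unfolding has_symbol_def
proof (intro allI impI)
  fix F f assume F: "represents \<alpha> F f"
  then have cont: "continuous_on {0..2 * pi} F" by (simp add: represents_def)
  then have "continuous_on {0..2 * pi} (\<lambda>\<theta>. M $ i $ j * F \<theta> $ j)" for i j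
    by (intro continuous_intros)
  then have "fourier_coeff (\<lambda>\<theta>. (M *v F \<theta>) $ i) x
      = M $ i $ 1 * fourier_coeff (\<lambda>\<theta>. F \<theta> $ 1) x + M $ i $ 2 * fourier_coeff (\<lambda>\<theta>. F \<theta> $ 2) x" for i x
    by (simp add: matrix_vector_mult_def sum_2 fourier_coeff_add fourier_coeff_cmult)
  moreover have "l2_apply (l2op_apply (matrix_op M) f) x $ i
      = M $ i $ 1 * l2_apply f x $ 1 + M $ i $ 2 * l2_apply f x $ 2" for i x
    by (simp add: matrix_op_apply matrix_vector_mult_def sum_2)
  ultimately show "represents \<alpha> (\<lambda>\<theta>. M *v F \<theta>) (l2op_apply (matrix_op M) f)"
    using F continuous_on_matrix_vector[OF cont]
    by (simp add: represents_def distrib_left mult.left_commute)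
qed

lemma mat_vector_nth: "(mat c *v v) $ i = c * (v $ i)" for c :: complex and v :: "complex^2"
  by (simp add: mat_def matrix_vector_mult_def if_distrib[of "\<lambda>c. c * _"] cong: if_cong)

lemma mat_vector: "mat c *v v = c *s v" for c :: complex and v :: "complex^2"
  by (simp add: vec_eq_iff mat_vector_nth)

lemma mat_mult_nth: "(mat c ** V) $ i $ j = c * (V $ i $ j)" for c :: complex and V :: "complex^2^2"
  by (simp add: mat_def matrix_matrix_mult_def if_distrib[of "\<lambda>c. c * _"] cong: if_cong)

text \<open>Shifting Fourier coefficients by \<open>y\<close> multiplies the loop by \<open>e\<^sup>i\<^sup>y\<^sup>\<theta>\<close>; compensating for the gauge
  contributes \<open>\<alpha>\<^sup>-\<^sup>y\<close>.\<close>

lemma has_symbol_shift: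
  assumes "\<alpha> \<noteq> 0"
  shows "has_symbol \<alpha> (shift y) (\<lambda>\<theta>. mat ((exp (\<i> * of_real \<theta>) / \<alpha>) powi y))"
  unfolding has_symbol_def
proof (intro allI impI)
  fix F f assume F: "represents \<alpha> F f"
  have e: "(exp (\<i> * of_real \<theta>) / \<alpha>) powi y = \<alpha> powi (- y) * exp (\<i> * of_int y * of_real \<theta>)" for \<theta>
    by (simp add: power_int_divide_distrib exp_power_int power_int_minus field_simps)
  show "represents \<alpha> (\<lambda>\<theta>. mat ((exp (\<i> * of_real \<theta>) / \<alpha>) powi y) *v F \<theta>) (l2op_apply (shift y) f)"
    unfolding represents_def
  proof (intro conjI allI)
    show "continuous_on {0..2 * pi} (\<lambda>\<theta>. mat ((exp (\<i> * of_real \<theta>) / \<alpha>) powi y) *v F \<theta>)"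
      using F unfolding represents_def e mat_vector vector_scalar_mult_def
      by (intro continuous_intros) simp
    fix x i
    have "fourier_coeff (\<lambda>\<theta>. (mat ((exp (\<i> * of_real \<theta>) / \<alpha>) powi y) *v F \<theta>) $ i) x
        = fourier_coeff (\<lambda>\<theta>. \<alpha> powi (- y) * (exp (\<i> * of_int y * of_real \<theta>) * F \<theta> $ i)) x"
      by (simp only: mat_vector_nth e mult.assoc)
    also have "\<dots> = \<alpha> powi (- y) * fourier_coeff (\<lambda>\<theta>. F \<theta> $ i) (x - y)"
      by (simp only: fourier_coeff_cmult fourier_coeff_translate)
    finally show "l2_apply (l2op_apply (shift y) f) x $ i =
      \<alpha> powi x * fourier_coeff (\<lambda>\<theta>. (mat ((exp (\<i> * of_real \<theta>) / \<alpha>) powi y) *v F \<theta>) $ i) x"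
      using F assms unfolding represents_def shift_apply
      by (simp flip: power_int_add mult.assoc)
  qed
qed

text \<open>Bounding the action by the entrywise Euclidean norm of \<open>M\<close>, whatever the constant, turns uniform
  convergence of symbols into uniform convergence of loops.\<close>

lemma norm_matrix_vector_le: "norm (M *v v) \<le> 4 * (norm M * norm v)"
  for M :: "complex^2^2" and v :: "complex^2"
proof -
  have "norm (M *v v) \<le> (\<Sum>i\<in>UNIV. norm ((M *v v) $ i))"
    by (simp add: norm_vec_def L2_set_le_sum)
  also have "\<dots> \<le> (\<Sum>i\<in>(UNIV :: 2 set). 2 * (norm M * norm v))"
  proof (rule sum_mono)
    fix i :: 2
    have "norm (M $ i $ j * v $ j) \<le> norm M * norm v" for j
      unfolding norm_mult
      by (intro mult_mono order_trans[OF Finite_Cartesian_Product.norm_nth_le Finite_Cartesian_Product.norm_nth_le]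
          Finite_Cartesian_Product.norm_nth_le norm_ge_zero)
    from this[of 1] this[of 2] show "norm ((M *v v) $ i) \<le> 2 * (norm M * norm v)"
      unfolding matrix_vector_mult_def vec_lambda_beta sum_2
      using norm_triangle_ineq[of "M $ i $ 1 * v $ 1" "M $ i $ 2 * v $ 2"] by linarith
  qed
  finally show ?thesis by simp
qed

lemma norm_l2op_apply_le: "norm (l2op_apply A f) \<le> norm A * norm f"
  unfolding l2op_apply_def norm_l2op.rep_eq by (rule norm_blinfun)

text \<open>A single Fourier coefficient depends continuously on the loop in the uniform norm, and a single
  entry of \<open>A f\<close> depends continuously on \<open>A\<close> in operator norm, so both sides of the defining
  identity converge. The filter is general because the exponential series is a limit of
  initial sums, while the series defining \<open>D(T)\<close> is a limit along finite sets of integers.\<close>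

lemma has_symbol_uniform_limit:
  assumes sym: "\<And>n. has_symbol \<alpha> (A n) (M n)"
    and lim: "(A \<longlongrightarrow> B) net" and ul: "uniform_limit {0..2 * pi} M L net" and net: "net \<noteq> bot"
  shows "has_symbol \<alpha> B L"
  unfolding has_symbol_def
proof (intro allI impI)
  fix F f assume F: "represents \<alpha> F f"
  then have contF: "continuous_on {0..2 * pi} F" by (simp add: represents_def)
  have A: "represents \<alpha> (\<lambda>\<theta>. M n \<theta> *v F \<theta>) (l2op_apply (A n) f)" for n
    by (rule has_symbolD[OF sym F])
  then have contM: "continuous_on {0..2 * pi} (\<lambda>\<theta>. M n \<theta> *v F \<theta>)" for n
    by (simp add: represents_def)
  have "bounded (F ` {0..2 * pi})"
    by (intro compact_imp_bounded compact_continuous_image contF) simp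
  then obtain C where C: "C > 0" "\<And>\<theta>. \<theta> \<in> {0..2 * pi} \<Longrightarrow> norm (F \<theta>) \<le> C"
    by (auto simp: bounded_pos)
  have ulF: "uniform_limit {0..2 * pi} (\<lambda>n \<theta>. M n \<theta> *v F \<theta>) (\<lambda>\<theta>. L \<theta> *v F \<theta>) net"
  proof (rule uniform_limitI)
    fix e :: real assume "e > 0"
    then have "e / (4 * C) > 0" using C by simp
    from uniform_limitD[OF ul this]
    show "\<forall>\<^sub>F n in net. \<forall>\<theta>\<in>{0..2 * pi}. dist (M n \<theta> *v F \<theta>) (L \<theta> *v F \<theta>) < e"
    proof (eventually_elim, intro ballI)
      fix n \<theta> assume *: "\<forall>\<theta>\<in>{0..2 * pi}. dist (M n \<theta>) (L \<theta>) < e / (4 * C)" and \<theta>: "\<theta> \<in> {0..2 * pi}"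
      have "dist (M n \<theta> *v F \<theta>) (L \<theta> *v F \<theta>) = norm ((M n \<theta> - L \<theta>) *v F \<theta>)"
        by (simp add: dist_norm matrix_vector_mult_diff_rdistrib)
      also have "\<dots> \<le> 4 * (norm (M n \<theta> - L \<theta>) * norm (F \<theta>))"
        by (rule norm_matrix_vector_le)
      also have "\<dots> \<le> 4 * (norm (M n \<theta> - L \<theta>) * C)"
        using C(2)[OF \<theta>] by (intro mult_left_mono) auto
      also have "\<dots> < e"
        using *[rule_format, OF \<theta>] C(1) by (simp add: dist_norm field_simps)
      finally show "dist (M n \<theta> *v F \<theta>) (L \<theta> *v F \<theta>) < e" .
    qed
  qed
  show "represents \<alpha> (\<lambda>\<theta>. L \<theta> *v F \<theta>) (l2op_apply B f)"
    unfolding represents_def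
  proof (intro conjI allI)
    show "continuous_on {0..2 * pi} (\<lambda>\<theta>. L \<theta> *v F \<theta>)"
      by (rule uniform_limit_theorem[OF _ ulF net]) (simp add: contM)
    fix x i
    have "((\<lambda>n. fourier_coeff (\<lambda>\<theta>. (M n \<theta> *v F \<theta>) $ i) x) \<longlongrightarrow> fourier_coeff (\<lambda>\<theta>. (L \<theta> *v F \<theta>) $ i) x) net"
    proof (rule fourier_coeff_tendsto[OF _ _ net])
      show "uniform_limit {0..2 * pi} (\<lambda>n \<theta>. (M n \<theta> *v F \<theta>) $ i) (\<lambda>\<theta>. (L \<theta> *v F \<theta>) $ i) net"
        by (rule bounded_linear.uniform_limit[OF bounded_linear_vec_nth ulF])
    qed (intro continuous_intros contM)
    then have "((\<lambda>n. l2_apply (l2op_apply (A n) f) x $ i)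
        \<longlongrightarrow> \<alpha> powi x * fourier_coeff (\<lambda>\<theta>. (L \<theta> *v F \<theta>) $ i) x) net"
      using A by (auto simp: represents_def intro!: tendsto_intros)
    moreover have "((\<lambda>n. l2_apply (l2op_apply (A n) f) x $ i) \<longlongrightarrow> l2_apply (l2op_apply B f) x $ i) net"
    proof (rule LIM_zero_cancel, rule Lim_null_comparison)
      show "((\<lambda>n. norm (A n - B) * norm f) \<longlongrightarrow> 0) net"
        using tendsto_mult_left_zero[OF tendsto_norm_zero[OF LIM_zero[OF lim]]] .
      have "norm (l2_apply (l2op_apply (A n) f) x $ i - l2_apply (l2op_apply B f) x $ i)
          \<le> norm (A n - B) * norm f" for n
      proof -
        have "norm (l2_apply (l2op_apply (A n - B) f) x $ i) \<le> norm (l2op_apply (A n - B) f)"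
          by (rule order_trans[OF Finite_Cartesian_Product.norm_nth_le norm_l2_apply_le])
        then show ?thesis using norm_l2op_apply_le[of "A n - B" f]
          by (simp add: l2op_apply_simps minus_l2.rep_eq)
      qed
      then show "\<forall>\<^sub>F n in net. norm (l2_apply (l2op_apply (A n) f) x $ i - l2_apply (l2op_apply B f) x $ i)
          \<le> norm (A n - B) * norm f"
        by simp
    qed
    ultimately show "l2_apply (l2op_apply B f) x $ i = \<alpha> powi x * fourier_coeff (\<lambda>\<theta>. (L \<theta> *v F \<theta>) $ i) x"
      using tendsto_unique[OF net] by blast
  qed
qed

lift_definition l2_delta :: "int \<Rightarrow> complex^2 \<Rightarrow> l2" is "\<lambda>y v x. if x = y then v else 0"
  by (rule finite_nonzero_values_imp_summable_on) (rule finite_subset[of _ "{_}"], auto)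

text \<open>The factor \<open>\<alpha>\<^sup>-\<^sup>y\<close> cancels the gauge at the only point of the support.\<close>

lemma represents_delta:
  assumes "\<alpha> \<noteq> 0"
  shows "represents \<alpha> (\<lambda>\<theta>. (\<alpha> powi (- y) * exp (\<i> * of_int y * of_real \<theta>)) *s v) (l2_delta y v)"
  unfolding represents_def
proof (intro conjI allI)
  show "continuous_on {0..2 * pi} (\<lambda>\<theta>. (\<alpha> powi (- y) * exp (\<i> * of_int y * of_real \<theta>)) *s v)"
    unfolding vector_scalar_mult_def by (intro continuous_intros)
  fix x i
  have "fourier_coeff (\<lambda>\<theta>. ((\<alpha> powi (- y) * exp (\<i> * of_int y * of_real \<theta>)) *s v) $ i) x
      = fourier_coeff (\<lambda>\<theta>. (\<alpha> powi (- y) * v $ i) * (exp (\<i> * of_int y * of_real \<theta>) * 1)) x"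
    by (simp add: mult_ac)
  also have "\<dots> = (if x = y then \<alpha> powi (- y) * v $ i else 0)"
    by (simp only: fourier_coeff_cmult fourier_coeff_translate fourier_coeff_one) simp
  finally show "l2_apply (l2_delta y v) x $ i = \<alpha> powi x *
      fourier_coeff (\<lambda>\<theta>. ((\<alpha> powi (- y) * exp (\<i> * of_int y * of_real \<theta>)) *s v) $ i) x"
    using assms by (simp add: l2_delta.rep_eq power_int_minus)
qed

lemma represents_unique: "represents \<alpha> F f \<Longrightarrow> represents \<alpha> F g \<Longrightarrow> f = g"
  by (rule l2_eqI) (simp add: represents_def vec_eq_iff)

lemma l2_deltas_dense: "((\<lambda>y. l2_delta y (l2_apply f y)) has_sum f) UNIV"
  unfolding has_sum_def
proof (rule tendstoI)
  fix e :: real assume "e > 0"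
  define h where "h x = (norm (l2_apply f x))\<^sup>2" for x
  have h: "h summable_on UNIV" unfolding h_def by (rule l2_summable)
  then have "(sum h \<longlongrightarrow> infsum h UNIV) (finite_subsets_at_top UNIV)"
    by (simp add: has_sum_def[symmetric])
  then have "\<forall>\<^sub>F F in finite_subsets_at_top UNIV. dist (sum h F) (infsum h UNIV) < e\<^sup>2"
    by (rule tendstoD) (use \<open>e > 0\<close> in simp)
  moreover have "\<forall>\<^sub>F F in finite_subsets_at_top (UNIV :: int set). finite F"
    by (rule eventually_finite_subsets_at_top_weakI)
  ultimately show "\<forall>\<^sub>F F in finite_subsets_at_top UNIV. dist (\<Sum>y\<in>F. l2_delta y (l2_apply f y)) f < e"
  proof eventually_elim
    case (elim F)
    have app: "l2_apply (\<Sum>y\<in>F. l2_delta y (l2_apply f y)) x = (if x \<in> F then l2_apply f x else 0)" for x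
    proof -
      have "l2_apply (\<Sum>y\<in>F. l2_delta y (l2_apply f y)) x = (\<Sum>y\<in>F. l2_apply (l2_delta y (l2_apply f y)) x)"
        by (induction F rule: infinite_finite_induct) (simp_all add: zero_l2.rep_eq plus_l2.rep_eq)
      then show ?thesis using elim by (simp add: l2_delta.rep_eq)
    qed
    have "(norm (f - (\<Sum>y\<in>F. l2_delta y (l2_apply f y))))\<^sup>2 = (\<Sum>\<^sub>\<infinity>x\<in>- F. h x)"
      unfolding norm_l2_sq by (rule infsum_cong_neutral) (auto simp: minus_l2.rep_eq app h_def)
    also have "\<dots> = infsum h UNIV - sum h F"
      using infsum_Diff[OF h, of F] elim by (simp add: Compl_eq_Diff_UNIV summable_on_finite)
    also have "\<dots> < e\<^sup>2" using elim by (simp add: dist_real_def)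
    finally show ?case
      using \<open>e > 0\<close> by (simp add: dist_norm norm_minus_commute power_less_imp_less_base)
  qed
qed

text \<open>Point masses are represented, so the symbol determines the operator on them, and they span a
  dense subspace.\<close>

lemma has_symbol_unique:
  assumes "has_symbol \<alpha> A M" "has_symbol \<alpha> B M" "\<alpha> \<noteq> 0"
  shows "A = B"
proof (rule l2op_eqI)
  fix f
  have bl: "bounded_linear (l2op_apply A)" for A
    unfolding l2op_apply_def by (rule blinfun.bounded_linear_right)
  have "l2op_apply A (l2_delta y v) = l2op_apply B (l2_delta y v)" for y v
    using represents_unique has_symbolD[OF assms(1) represents_delta[OF assms(3)]]
      has_symbolD[OF assms(2) represents_delta[OF assms(3)]] by blast
  then have eq: "(\<lambda>y. l2op_apply A (l2_delta y (l2_apply f y))) = (\<lambda>y. l2op_apply B (l2_delta y (l2_apply f y)))"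
    by (rule ext)
  have "((\<lambda>y. l2op_apply C (l2_delta y (l2_apply f y))) has_sum l2op_apply C f) UNIV" for C
    by (rule has_sum_bounded_linear[OF bl l2_deltas_dense])
  from this[of A, unfolded eq] this[of B] show "l2op_apply A f = l2op_apply B f"
    by (rule has_sum_unique)
qed

section \<open>Functions with absolutely convergent Fourier series\<close>

text \<open>Membership in the Wiener algebra, with \<open>K\<close> an upper bound for the Wiener norm. Recovery of
  the function from its coefficients, at every point, is part of the definition and is carried along
  by the closure properties below.\<close>

definition absolute_fourier :: "(real \<Rightarrow> complex) \<Rightarrow> real \<Rightarrow> bool"
  where "absolute_fourier g K \<longleftrightarrow> continuous_on {0..2 * pi} g \<and>
    (\<lambda>y. norm (fourier_coeff g y)) summable_on UNIV \<and>
    (\<Sum>\<^sub>\<infinity>y. norm (fourier_coeff g y)) \<le> K \<and>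
    (\<forall>\<theta>. ((\<lambda>y. fourier_coeff g y * exp (\<i> * of_int y * of_real \<theta>)) has_sum g \<theta>) UNIV)"

text \<open>The Wiener norm dominates the supremum norm.\<close>

lemma absolute_fourier_norm_le:
  assumes "absolute_fourier g K"
  shows "norm (g \<theta>) \<le> K"
proof -
  have e: "norm (fourier_coeff g y * exp (\<i> * of_int y * of_real \<theta>)) = norm (fourier_coeff g y)" for y
    by (simp add: norm_mult)
  have "g \<theta> = (\<Sum>\<^sub>\<infinity>y. fourier_coeff g y * exp (\<i> * of_int y * of_real \<theta>))"
    using assms unfolding absolute_fourier_def by (metis infsumI)
  also have "norm \<dots> \<le> (\<Sum>\<^sub>\<infinity>y. norm (fourier_coeff g y * exp (\<i> * of_int y * of_real \<theta>)))"
    by (rule norm_infsum_bound) (use assms in \<open>simp only: e absolute_fourier_def\<close>)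
  also have "\<dots> \<le> K"
    using assms by (simp only: e absolute_fourier_def)
  finally show ?thesis .
qed

lemma absolute_fourier_one: "absolute_fourier (\<lambda>_. 1) 1"
  unfolding absolute_fourier_def
proof (intro conjI allI)
  have n: "((\<lambda>y::int. norm (fourier_coeff (\<lambda>_. 1) y)) has_sum 1) UNIV"
    by (rule has_sum_finite_neutralI[of "{0}"]) (auto simp: fourier_coeff_one)
  then show "(\<lambda>y. norm (fourier_coeff (\<lambda>_. 1) y)) summable_on UNIV" "(\<Sum>\<^sub>\<infinity>y. norm (fourier_coeff (\<lambda>_. 1) y)) \<le> 1"
    by (auto simp: summable_on_def infsumI)
  show "((\<lambda>y. fourier_coeff (\<lambda>_. 1) y * exp (\<i> * of_int y * of_real \<theta>)) has_sum 1) UNIV" for \<theta>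
    by (rule has_sum_finite_neutralI[of "{0}"]) (auto simp: fourier_coeff_one)
qed simp

lemma absolute_fourier_cmult:
  assumes "absolute_fourier g K"
  shows "absolute_fourier (\<lambda>\<theta>. c * g \<theta>) (norm c * K)"
  using assms unfolding absolute_fourier_def fourier_coeff_cmult norm_mult mult.assoc
  by (auto intro!: continuous_intros summable_on_cmult_right has_sum_cmult_right mult_left_mono
      simp: infsum_cmult_right')

lemma absolute_fourier_add:
  assumes "absolute_fourier g K" "absolute_fourier h L"
  shows "absolute_fourier (\<lambda>\<theta>. g \<theta> + h \<theta>) (K + L)"
proof -
  have add: "fourier_coeff (\<lambda>\<theta>. g \<theta> + h \<theta>) y = fourier_coeff g y + fourier_coeff h y" for y
    using assms by (intro fourier_coeff_add) (auto simp: absolute_fourier_def)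
  note s = assms[unfolded absolute_fourier_def, THEN conjunct2, THEN conjunct1]
  have s2: "(\<lambda>y. norm (fourier_coeff g y) + norm (fourier_coeff h y)) summable_on UNIV"
    by (intro summable_on_add s)
  have s3: "(\<lambda>y. norm (fourier_coeff g y + fourier_coeff h y)) summable_on UNIV"
    by (rule Infinite_Sum.abs_summable_on_comparison_test'[OF s2 norm_triangle_ineq])
  have "(\<Sum>\<^sub>\<infinity>y. norm (fourier_coeff g y + fourier_coeff h y))
      \<le> (\<Sum>\<^sub>\<infinity>y. norm (fourier_coeff g y) + norm (fourier_coeff h y))"
    by (rule infsum_mono[OF s3 s2 norm_triangle_ineq])
  also have "\<dots> = (\<Sum>\<^sub>\<infinity>y. norm (fourier_coeff g y)) + (\<Sum>\<^sub>\<infinity>y. norm (fourier_coeff h y))"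
    by (rule infsum_add[OF s])
  also have "\<dots> \<le> K + L"
    using assms by (intro add_mono) (auto simp: absolute_fourier_def)
  finally show ?thesis
    using assms s3 unfolding absolute_fourier_def add distrib_right
    by (auto intro!: continuous_intros has_sum_add)
qed

lemma absolute_fourier_translate:
  assumes "absolute_fourier g K"
  shows "absolute_fourier (\<lambda>\<theta>. exp (\<i> * of_int k * of_real \<theta>) * g \<theta>) K"
  unfolding absolute_fourier_def fourier_coeff_translate
proof (intro conjI allI)
  show "continuous_on {0..2 * pi} (\<lambda>\<theta>. exp (\<i> * of_int k * of_real \<theta>) * g \<theta>)"
    using assms unfolding absolute_fourier_def by (auto intro!: continuous_intros)
  show "(\<lambda>y. norm (fourier_coeff g (y - k))) summable_on UNIV"
    using assms summable_on_reindex_bij_betw[OF bij_int_shift, of "\<lambda>y. norm (fourier_coeff g y)" k]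
    by (simp add: absolute_fourier_def)
  show "(\<Sum>\<^sub>\<infinity>y. norm (fourier_coeff g (y - k))) \<le> K"
    using assms infsum_reindex_bij_betw[OF bij_int_shift, of "\<lambda>y. norm (fourier_coeff g y)" k]
    by (simp add: absolute_fourier_def)
  fix \<theta>
  have "((\<lambda>y. fourier_coeff g (y - k) * exp (\<i> * of_int (y - k) * of_real \<theta>)) has_sum g \<theta>) UNIV"
    using assms has_sum_reindex_bij_betw[OF bij_int_shift,
        of "\<lambda>y. fourier_coeff g y * exp (\<i> * of_int y * of_real \<theta>)" k "g \<theta>"]
    unfolding absolute_fourier_def by blast
  then have "((\<lambda>y. exp (\<i> * of_int k * of_real \<theta>) *
      (fourier_coeff g (y - k) * exp (\<i> * of_int (y - k) * of_real \<theta>)))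
      has_sum exp (\<i> * of_int k * of_real \<theta>) * g \<theta>) UNIV"
    by (rule has_sum_cmult_right)
  moreover have "exp (\<i> * of_int k * of_real \<theta>) * (c * exp (\<i> * of_int (y - k) * of_real \<theta>))
      = c * exp (\<i> * of_int y * of_real \<theta>)" for c y
  proof -
    have "exp (\<i> * of_int k * of_real \<theta>) * exp (\<i> * of_int (y - k) * of_real \<theta>)
        = exp (\<i> * of_int y * of_real \<theta>)"
      unfolding exp_add[symmetric] by (simp add: algebra_simps)
    then show ?thesis by (simp only: mult.left_commute)
  qed
  ultimately show "((\<lambda>y. fourier_coeff g (y - k) * exp (\<i> * of_int y * of_real \<theta>))
      has_sum exp (\<i> * of_int k * of_real \<theta>) * g \<theta>) UNIV"
    by (simp only:)
qed

lemma cos_exp: "complex_of_real (cos \<theta>) = (exp (\<i> * of_int 1 * of_real \<theta>) + exp (\<i> * of_int (- 1) * of_real \<theta>)) / 2"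
  by (simp add: cos_exp_eq flip: cos_of_real)

lemma sin_exp: "complex_of_real (sin \<theta>) = (exp (\<i> * of_int 1 * of_real \<theta>) - exp (\<i> * of_int (- 1) * of_real \<theta>)) / (2 * \<i>)"
  by (simp add: sin_exp_eq flip: sin_of_real)

text \<open>Multiplication by \<open>cos\<close> averages two translates of the coefficient sequence, hence does not increase
  the Wiener norm. This keeps the norm of \<open>(s cos \<theta>)\<^sup>n\<close> below \<open>s\<^sup>n\<close>, which is what the power series of
  the phase can be summed against.\<close>

lemma absolute_fourier_cos:
  assumes "absolute_fourier g K"
  shows "absolute_fourier (\<lambda>\<theta>. complex_of_real (cos \<theta>) * g \<theta>) K"
proof -
  let ?e = "\<lambda>k \<theta>. exp (\<i> * of_int k * complex_of_real \<theta>)"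
  have "complex_of_real (cos \<theta>) * g \<theta> = 1 / 2 * (?e 1 \<theta> * g \<theta>) + 1 / 2 * (?e (- 1) \<theta> * g \<theta>)" for \<theta>
    unfolding cos_exp by (simp add: field_simps)
  moreover have "absolute_fourier (\<lambda>\<theta>. 1 / 2 * (?e 1 \<theta> * g \<theta>) + 1 / 2 * (?e (- 1) \<theta> * g \<theta>))
      (norm (1 / 2 :: complex) * K + norm (1 / 2 :: complex) * K)"
    by (intro absolute_fourier_add absolute_fourier_cmult absolute_fourier_translate assms)
  moreover have "norm (1 / 2 :: complex) * K + norm (1 / 2 :: complex) * K = K"
    by (simp add: norm_divide norm_mult)
  ultimately show ?thesis by (simp only:)
qed

lemma absolute_fourier_sin:
  assumes "absolute_fourier g K"
  shows "absolute_fourier (\<lambda>\<theta>. complex_of_real (sin \<theta>) * g \<theta>) K"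
proof -
  let ?e = "\<lambda>k \<theta>. exp (\<i> * of_int k * complex_of_real \<theta>)"
  have "complex_of_real (sin \<theta>) * g \<theta> = (1 / (2 * \<i>)) * (?e 1 \<theta> * g \<theta>) + (- 1 / (2 * \<i>)) * (?e (- 1) \<theta> * g \<theta>)" for \<theta>
    unfolding sin_exp by (simp add: field_simps)
  moreover have "absolute_fourier (\<lambda>\<theta>. (1 / (2 * \<i>)) * (?e 1 \<theta> * g \<theta>) + (- 1 / (2 * \<i>)) * (?e (- 1) \<theta> * g \<theta>))
      (norm ((1 / (2 * \<i>)) :: complex) * K + norm ((- 1 / (2 * \<i>)) :: complex) * K)"
    by (intro absolute_fourier_add absolute_fourier_cmult absolute_fourier_translate assms)
  moreover have "norm ((1 / (2 * \<i>)) :: complex) * K + norm ((- 1 / (2 * \<i>)) :: complex) * K = K"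
    by (simp add: norm_divide norm_mult)
  ultimately show ?thesis by (simp only:)
qed

lemma absolute_fourier_cos_power:
  assumes "0 \<le> s"
  shows "absolute_fourier (\<lambda>\<theta>. (of_real (s * cos \<theta>)) ^ n) (s ^ n)"
proof (induction n)
  case 0
  then show ?case using absolute_fourier_one by simp
next
  case (Suc n)
  have "absolute_fourier (\<lambda>\<theta>. of_real s * (of_real (cos \<theta>) * (of_real (s * cos \<theta>)) ^ n)) (norm (of_real s :: complex) * s ^ n)"
    by (intro absolute_fourier_cmult absolute_fourier_cos Suc)
  then show ?case using assms by (simp add: mult.assoc)
qed

lemma fourier_coeff_sum:
  assumes "\<And>k. k \<in> A \<Longrightarrow> continuous_on {0..2 * pi} (g k)" "finite A"
  shows "fourier_coeff (\<lambda>\<theta>. \<Sum>k\<in>A. g k \<theta>) y = (\<Sum>k\<in>A. fourier_coeff (g k) y)"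
  using assms(2,1)
proof (induction A)
  case empty
  then show ?case by (simp add: fourier_coeff_def)
next
  case (insert k A)
  then show ?case by (simp add: fourier_coeff_add continuous_on_sum)
qed

text \<open>Completeness of the Wiener algebra: the double family \<open>h n * c n y\<close>, with \<open>c n\<close> the coefficients
  of \<open>u n\<close>, is absolutely summable, so the sum over \<open>n\<close> that expresses \<open>g\<close> and the sum over
  frequencies \<open>y\<close> may be exchanged.\<close>

lemma absolute_fourier_suminf:
  assumes u: "\<And>n. absolute_fourier (u n) (K n)"
    and K: "summable (\<lambda>n. norm (h n) * K n)"
    and g: "\<And>\<theta>. (\<lambda>n. h n * u n \<theta>) sums g \<theta>"
  shows "\<exists>L. absolute_fourier g L"
proof -
  define c where "c n y = fourier_coeff (u n) y" for n y
  define e where "e \<theta> y = exp (\<i> * of_int y * complex_of_real \<theta>)" for \<theta> y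
  have ne: "norm (e \<theta> y) = 1" for \<theta> y by (simp add: e_def)
  have cs: "(\<lambda>y. norm (c n y)) summable_on UNIV" and cK: "(\<Sum>\<^sub>\<infinity>y. norm (c n y)) \<le> K n"
    and cu: "((\<lambda>y. c n y * e \<theta> y) has_sum u n \<theta>) UNIV"
    and cont: "continuous_on {0..2 * pi} (u n)" for n \<theta>
    using u[of n] by (simp_all add: absolute_fourier_def c_def e_def)
  have c0: "0 \<le> (\<Sum>\<^sub>\<infinity>y. norm (c n y))" for n by (rule infsum_nonneg) simp
  have cle: "norm (c n y) \<le> K n" for n y
  proof -
    have "(\<Sum>y\<in>{y}. norm (c n y)) \<le> (\<Sum>\<^sub>\<infinity>y. norm (c n y))"
      by (rule finite_sum_le_infsum[OF cs]) auto
    then show ?thesis using cK[of n] by simp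
  qed
  have hu: "norm (h n * u n \<theta>) \<le> norm (h n) * K n" for n \<theta>
    unfolding norm_mult by (intro mult_left_mono absolute_fourier_norm_le[OF u]) simp
  have "uniform_limit {0..2 * pi} (\<lambda>N \<theta>. \<Sum>n<N. h n * u n \<theta>) (\<lambda>\<theta>. \<Sum>n. h n * u n \<theta>) sequentially"
    by (rule Weierstrass_m_test[OF hu K])
  then have ul: "uniform_limit {0..2 * pi} (\<lambda>N \<theta>. \<Sum>n<N. h n * u n \<theta>) g sequentially"
    unfolding g[THEN sums_unique, symmetric] .
  have contp: "continuous_on {0..2 * pi} (\<lambda>\<theta>. \<Sum>n<N. h n * u n \<theta>)" for N
    by (intro continuous_intros cont)
  have contg: "continuous_on {0..2 * pi} g"
    by (rule uniform_limit_theorem[OF _ ul]) (simp_all add: contp)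
  have "(\<lambda>N. fourier_coeff (\<lambda>\<theta>. \<Sum>n<N. h n * u n \<theta>) y) \<longlonglongrightarrow> fourier_coeff g y" for y
    by (rule fourier_coeff_tendsto[OF ul contp]) simp
  moreover have "fourier_coeff (\<lambda>\<theta>. \<Sum>n<N. h n * u n \<theta>) y = (\<Sum>n<N. h n * c n y)" for N y
    by (subst fourier_coeff_sum) (auto intro!: continuous_intros cont simp: fourier_coeff_cmult c_def)
  ultimately have cg_sums: "(\<lambda>n. h n * c n y) sums fourier_coeff g y" for y
    by (simp add: sums_def)
  have hc_abs: "summable (\<lambda>n. norm (h n * c n y))" for y
    by (rule summable_comparison_test'[OF K, of 0]) (simp add: norm_mult cle mult_left_mono)
  have cg: "((\<lambda>n. h n * c n y) has_sum fourier_coeff g y) UNIV" for y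
    by (rule norm_summable_imp_has_sum[OF hc_abs cg_sums])
  \<comment> \<open>The majorant of the double family; it does not depend on the angle.\<close>
  define p where "p = (\<lambda>(n, y). norm (h n) * norm (c n y))"
  have p: "p summable_on UNIV \<times> UNIV"
  proof (rule summable_on_SigmaI)
    show "((\<lambda>y. p (n, y)) has_sum norm (h n) * (\<Sum>\<^sub>\<infinity>y. norm (c n y))) UNIV" for n
      unfolding p_def by (simp add: has_sum_cmult_right cs)
    show "(\<lambda>n. norm (h n) * (\<Sum>\<^sub>\<infinity>y. norm (c n y))) summable_on UNIV"
    proof (rule summable_on_comparison_test)
      show "(\<lambda>n. norm (h n) * K n) summable_on UNIV"
        by (rule norm_summable_imp_summable_on)
          (use K in \<open>simp add: norm_mult abs_of_nonneg order_trans[OF c0 cK]\<close>)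
    qed (auto intro!: mult_left_mono cK mult_nonneg_nonneg c0)
  qed (auto simp: p_def)
  then have p': "(\<lambda>(y, n). p (n, y)) summable_on UNIV \<times> UNIV"
    by (subst (asm) summable_on_swap)
  have "(\<lambda>y. \<Sum>\<^sub>\<infinity>n. p (n, y)) summable_on UNIV"
    using summable_on_Sigma_banach[OF p'] by simp
  then have sumg: "(\<lambda>y. norm (fourier_coeff g y)) summable_on UNIV"
  proof (rule Infinite_Sum.abs_summable_on_comparison_test')
    fix y
    have "(\<lambda>n. norm (h n * c n y)) summable_on UNIV"
      using hc_abs[of y] by (intro norm_summable_imp_summable_on) simp
    then have "norm (\<Sum>\<^sub>\<infinity>n. h n * c n y) \<le> (\<Sum>\<^sub>\<infinity>n. norm (h n * c n y))"
      by (rule norm_infsum_bound)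
    then show "norm (fourier_coeff g y) \<le> (\<Sum>\<^sub>\<infinity>n. p (n, y))"
      using infsumI[OF cg] by (simp add: p_def norm_mult)
  qed
  have "((\<lambda>y. fourier_coeff g y * e \<theta> y) has_sum g \<theta>) UNIV" for \<theta>
  proof -
    define q where "q = (\<lambda>(n, y). h n * (c n y * e \<theta> y))"
    have "norm (q z) = p z" for z
      by (cases z) (simp add: q_def p_def norm_mult ne)
    then have qs: "q summable_on UNIV \<times> UNIV"
      using p by - (rule abs_summable_summable, simp)
    have "(q has_sum g \<theta>) (UNIV \<times> UNIV)"
    proof (rule has_sum_SigmaI[OF _ _ qs])
      show "((\<lambda>y. q (n, y)) has_sum h n * u n \<theta>) UNIV" for n
        unfolding q_def by (simp add: has_sum_cmult_right cu)
      show "((\<lambda>n. h n * u n \<theta>) has_sum g \<theta>) UNIV"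
      proof (rule norm_summable_imp_has_sum[OF _ g])
        show "summable (\<lambda>n. norm (h n * u n \<theta>))"
          by (rule summable_comparison_test'[OF K, of 0]) (use hu in simp)
      qed
    qed
    then have "((\<lambda>(y, n). q (n, y)) has_sum g \<theta>) (UNIV \<times> UNIV)"
      by (subst (asm) has_sum_swap)
    then show ?thesis
    proof (rule has_sum_SigmaD)
      show "((\<lambda>n. case (y, n) of (y, n) \<Rightarrow> q (n, y)) has_sum fourier_coeff g y * e \<theta> y) UNIV" for y
        using has_sum_cmult_left[OF cg[of y], of "e \<theta> y"] by (simp add: q_def mult.assoc)
    qed
  qed
  then show ?thesis
    unfolding absolute_fourier_def e_def using contg sumg by blast
qed

text \<open>The complex function \<open>Arccos z / sin (Arccos z)\<close> is holomorphic on the unit disc, since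
  \<open>sin\<^sup>2 (Arccos z) = 1 - z\<^sup>2\<close> has no zero there.\<close>

lemma arccos_over_sin_power_series:
  obtains h :: "nat \<Rightarrow> complex"
  where "\<And>u. \<bar>u\<bar> < 1 \<Longrightarrow> (\<lambda>n. h n * of_real u ^ n) sums of_real (arccos u / sin (arccos u))"
proof
  define f where "f z = Arccos z / sin (Arccos z)" for z
  fix u :: real assume u: "\<bar>u\<bar> < 1"
  have nz: "sin (Arccos z) \<noteq> 0" if "z \<in> ball 0 1" for z
  proof
    assume "sin (Arccos z) = 0"
    then have "z\<^sup>2 = 1" using sin_cos_squared_add[of "Arccos z"] by simp
    then have "norm z ^ 2 = 1" by (metis norm_one norm_power)
    then have "norm z = 1" using norm_ge_zero[of z] unfolding power2_eq_1_iff by linarith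
    then show False using that by simp
  qed
  have "\<bar>Re z\<bar> < 1" if "z \<in> ball 0 1" for z :: complex
    using that abs_Re_le_cmod[of z] by simp
  then have "Arccos holomorphic_on ball 0 1"
    by (intro holomorphic_on_Arccos) auto
  then have "f holomorphic_on ball 0 1"
    unfolding f_def
    by (intro holomorphic_on_divide nz holomorphic_on_compose[of Arccos _ sin, unfolded o_def])
      (auto intro: holomorphic_on_sin)
  then have "(\<lambda>n. (deriv ^^ n) f 0 / fact n * (of_real u - 0) ^ n) sums f (of_real u)"
    by (rule holomorphic_power_series) (use u in simp)
  then show "(\<lambda>n. (deriv ^^ n) f 0 / fact n * of_real u ^ n) sums of_real (arccos u / sin (arccos u))"
    using u by (simp add: f_def of_real_arccos flip: sin_of_real)
qed

text \<open>Here \<open>s < 1\<close> is essential: the power series is evaluated at \<open>s cos \<theta>\<close>, and its coefficients are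
  absolutely summable against \<open>s\<^sup>n\<close> because \<open>s\<close> lies inside the disc of convergence.\<close>

lemma absolute_fourier_phase:
  assumes "0 \<le> s" "s < 1"
  shows "\<exists>L. absolute_fourier (\<lambda>\<theta>. of_real (phase s \<theta> / sin (phase s \<theta>))) L"
proof -
  obtain h :: "nat \<Rightarrow> complex" where
    h: "\<And>u. \<bar>u\<bar> < 1 \<Longrightarrow> (\<lambda>n. h n * of_real u ^ n) sums of_real (arccos u / sin (arccos u))"
    using arccos_over_sin_power_series by blast
  show ?thesis
  proof (rule absolute_fourier_suminf)
    show "absolute_fourier (\<lambda>\<theta>. of_real (s * cos \<theta>) ^ n) (s ^ n)" for n
      by (rule absolute_fourier_cos_power[OF assms(1)])
    \<comment> \<open>A radius between \<open>s\<close> and 1 turns convergence into absolute convergence at \<open>s\<close>.\<close>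
    obtain t where t: "s < t" "t < 1" using assms(2) dense by blast
    then have "summable (\<lambda>n. h n * of_real t ^ n)"
      using h[of t] assms by (intro sums_summable) auto
    then have "summable (\<lambda>n. norm (h n * of_real s ^ n))"
      by (rule powser_insidea) (use t assms in simp)
    then show "summable (\<lambda>n. norm (h n) * s ^ n)"
      using assms by (simp add: norm_mult norm_power)
    fix \<theta>
    have "s * \<bar>cos \<theta>\<bar> \<le> s * 1" by (rule mult_left_mono) (use assms in auto)
    then have "\<bar>s * cos \<theta>\<bar> < 1" using assms by (simp add: abs_mult)
    then show "(\<lambda>n. h n * of_real (s * cos \<theta>) ^ n) sums of_real (phase s \<theta> / sin (phase s \<theta>))"
      unfolding phase_def by (rule h)
  qed
qed

section \<open>Scalar multiples of two by two matrices\<close>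

definition mat2 :: "complex \<Rightarrow> complex \<Rightarrow> complex \<Rightarrow> complex \<Rightarrow> complex^2^2"
  where "mat2 p q u v = vector [vector [p, q], vector [u, v]]"

lemma mat2_nth [simp]:
  "mat2 p q u v $ 1 $ 1 = p" "mat2 p q u v $ 1 $ 2 = q"
  "mat2 p q u v $ 2 $ 1 = u" "mat2 p q u v $ 2 $ 2 = v"
  by (simp_all add: mat2_def)

lemma mat_eq_iff2:
  "M = N \<longleftrightarrow> M $ 1 $ 1 = N $ 1 $ 1 \<and> M $ 1 $ 2 = N $ 1 $ 2 \<and> M $ 2 $ 1 = N $ 2 $ 1 \<and> M $ 2 $ 2 = N $ 2 $ 2"
  for M N :: "complex^2^2"
  by (auto simp: vec_eq_iff forall_2)

lemma norm_mat_le: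
  "norm M \<le> norm (M $ 1 $ 1) + norm (M $ 1 $ 2) + norm (M $ 2 $ 1) + norm (M $ 2 $ 2)"
  for M :: "complex^2^2"
proof -
  have le: "norm v \<le> (\<Sum>i\<in>UNIV. norm (v $ i))" for v :: "'b::real_normed_vector ^ 2"
    unfolding norm_vec_def by (rule L2_set_le_sum) simp
  show ?thesis
    using le[of M] le[of "M $ 1"] le[of "M $ 2"] by (simp add: sum_2)
qed

text \<open>Throughout, \<open>mat c\<close> is the scalar matrix \<open>c\<close> times the identity, and multiplication by it plays the
  role of complex scalar multiplication on matrices.\<close>

lemma mat_mult_mat_mult: "(mat c ** A) ** (mat d ** B) = mat (c * d) ** (A ** B)"
  for A B :: "complex^2^2"
  unfolding mat_eq_iff2 mat_mult_nth
  by (simp add: matrix_matrix_mult_def[of A] matrix_matrix_mult_def[of "mat c ** A"] sum_2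
      mat_mult_nth algebra_simps)

lemma mult_mat_commute: "A ** mat d = mat d ** A" for A :: "complex^2^2"
  unfolding mat_eq_iff2 mat_mult_nth
  by (simp add: matrix_matrix_mult_def[of A] sum_2 mat_def)

lemma norm_mat_mult: "norm (mat c ** A) = norm c * norm A" for A :: "complex^2^2"
  by (simp add: norm_vec_def mat_mult_nth norm_mult L2_set_right_distrib)

lemma bounded_linear_mat_mult: "bounded_linear (\<lambda>c. mat c ** A)" for A :: "complex^2^2"
  by (rule bounded_linear_intro[where K = "norm A"])
    (simp_all add: norm_mat_mult vec_eq_iff mat_mult_nth distrib_right)

section \<open>Symbols of exponentials and of norm convergent sums of shifts\<close>

lemma has_symbol_one: "has_symbol \<alpha> 1 (\<lambda>_. mat 1)"
  by (simp add: has_symbol_def l2op_apply_simps)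

lemma has_symbol_scaleC:
  assumes "has_symbol \<alpha> B M"
  shows "has_symbol \<alpha> (c *\<^sub>C B) (\<lambda>\<theta>. mat c ** M \<theta>)"
proof -
  have "c *\<^sub>C B = matrix_op (mat c) * B"
    by (intro l2op_eqI l2_eqI) (simp add: l2op_apply_simps l2_scaleC.rep_eq matrix_op_apply mat_vector)
  then show ?thesis using has_symbol_mult[OF has_symbol_matrix assms] by simp
qed

lemma has_symbol_scaleR:
  assumes "has_symbol \<alpha> B M"
  shows "has_symbol \<alpha> (r *\<^sub>R B) (\<lambda>\<theta>. r *\<^sub>R M \<theta>)"
proof -
  have "r *\<^sub>R B = of_real r *\<^sub>C B"
    by (intro l2op_eqI l2_eqI)
      (simp add: l2op_apply_simps l2_scaleC.rep_eq scaleR_l2.rep_eq vec_eq_iff flip: scaleR_conv_of_real)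
  moreover have "mat (of_real r) ** A = r *\<^sub>R A" for A :: "complex^2^2"
    by (simp add: vec_eq_iff mat_mult_nth flip: scaleR_conv_of_real)
  ultimately show ?thesis using has_symbol_scaleC[OF assms, of "of_real r"] by simp
qed

text \<open>When \<open>V\<close> squares to the identity, the powers of \<open>p V\<close> alternate between scalar multiples of the
  identity and of \<open>V\<close>, so the exponential series splits into those of \<open>cosh\<close> and \<open>sinh\<close>. Boundedness
  of \<open>p\<close> and \<open>V\<close> makes the convergence uniform.\<close>

lemma has_symbol_exp:
  assumes X: "has_symbol \<alpha> X (\<lambda>\<theta>. mat (p \<theta>) ** V \<theta>)"
    and VV: "\<And>\<theta>. V \<theta> ** V \<theta> = mat 1"
    and p: "\<And>\<theta>. norm (p \<theta>) \<le> P" and V: "\<And>\<theta>. norm (V \<theta>) \<le> C"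
  shows "has_symbol \<alpha> (exp X) (\<lambda>\<theta>. mat (cosh (p \<theta>)) + mat (sinh (p \<theta>)) ** V \<theta>)"
proof -
  define N where "N k \<theta> = mat (p \<theta> ^ k) ** (if even k then mat 1 else V \<theta>)" for k \<theta>
  have pow: "has_symbol \<alpha> (X ^ k) (N k)" for k
  proof (induction k)
    case 0
    then show ?case using has_symbol_one by (simp add: N_def)
  next
    case (Suc k)
    have "N (Suc k) = (\<lambda>\<theta>. (mat (p \<theta>) ** V \<theta>) ** N k \<theta>)"
      unfolding N_def mat_mult_mat_mult by (rule ext) (simp add: VV)
    then show ?case using has_symbol_mult[OF X Suc] by simp
  qed
  define D where "D = norm (mat 1 :: complex^2^2) + C"
  have C0: "0 \<le> C" using V[of 0] norm_ge_zero order_trans by blast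
  have bound: "norm (N k \<theta> /\<^sub>R fact k) \<le> D * (inverse (fact k) * P ^ k)" for k \<theta>
  proof -
    have "norm (N k \<theta>) \<le> P ^ k * D"
      unfolding N_def norm_mat_mult norm_power
    proof (rule mult_mono)
      show "norm (p \<theta>) ^ k \<le> P ^ k" by (rule power_mono[OF p]) simp
      show "norm (if even k then mat 1 else V \<theta>) \<le> D"
        using V[of \<theta>] C0 by (simp add: D_def add_increasing)
      show "0 \<le> P ^ k" using order_trans[OF norm_ge_zero p] by (rule zero_le_power)
    qed simp
    then have "inverse (fact k) * norm (N k \<theta>) \<le> inverse (fact k) * (P ^ k * D)"
      by (rule mult_left_mono) simp
    then show ?thesis by (simp add: mult_ac)
  qed
  have "uniform_limit {0..2 * pi} (\<lambda>n \<theta>. \<Sum>k<n. N k \<theta> /\<^sub>R fact k) (\<lambda>\<theta>. \<Sum>k. N k \<theta> /\<^sub>R fact k) sequentially"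
    by (rule Weierstrass_m_test[OF bound]) (intro summable_mult summable_exp)
  moreover have "(\<Sum>k. N k \<theta> /\<^sub>R fact k) = mat (cosh (p \<theta>)) + mat (sinh (p \<theta>)) ** V \<theta>" for \<theta>
  proof -
    have "(\<lambda>k. mat (if even k then p \<theta> ^ k /\<^sub>R fact k else 0) ** mat 1
        + mat (if even k then 0 else p \<theta> ^ k /\<^sub>R fact k) ** V \<theta>)
        sums (mat (cosh (p \<theta>)) ** mat 1 + mat (sinh (p \<theta>)) ** V \<theta>)"
      by (intro sums_add bounded_linear.sums[OF bounded_linear_mat_mult] cosh_converges sinh_converges)
    moreover have "mat (if even k then p \<theta> ^ k /\<^sub>R fact k else 0) ** mat 1
        + mat (if even k then 0 else p \<theta> ^ k /\<^sub>R fact k) ** V \<theta> = N k \<theta> /\<^sub>R fact k" for k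
      by (cases "even k") (simp_all add: N_def vec_eq_iff mat_mult_nth del: matrix_mul_rid)
    ultimately show ?thesis by (simp add: sums_iff)
  qed
  ultimately have ul: "uniform_limit {0..2 * pi} (\<lambda>n \<theta>. \<Sum>k<n. N k \<theta> /\<^sub>R fact k)
      (\<lambda>\<theta>. mat (cosh (p \<theta>)) + mat (sinh (p \<theta>)) ** V \<theta>) sequentially"
    by simp
  have lim: "(\<lambda>n. \<Sum>k<n. X ^ k /\<^sub>R fact k) \<longlonglongrightarrow> exp X"
    using exp_converges[of X] by (simp add: sums_def)
  have "has_symbol \<alpha> (\<Sum>k<n. X ^ k /\<^sub>R fact k) (\<lambda>\<theta>. \<Sum>k<n. N k \<theta> /\<^sub>R fact k)" for n
    by (rule has_symbol_sum) (rule has_symbol_scaleR[OF pow])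
  from has_symbol_uniform_limit[OF this lim ul] show ?thesis by simp
qed

lemma norm_matrix_op_le: "norm (matrix_op M) \<le> 4 * norm M"
  unfolding norm_l2op.rep_eq
proof (rule norm_blinfun_bound)
  fix f
  have "norm (l2_matrix M f) \<le> (4 * norm M) * norm f"
    by (rule norm_l2_leI) (use norm_matrix_vector_le in \<open>simp_all add: l2_matrix.rep_eq mult.assoc\<close>)
  then show "norm (blinfun_apply (l2op_blinfun (matrix_op M)) f) \<le> 4 * norm M * norm f"
    by (simp add: matrix_op.rep_eq bounded_linear_Blinfun_apply[OF bounded_linear_l2_matrix])
qed simp

lemma norm_shift_le: "norm (shift y) \<le> 1"
  unfolding norm_l2op.rep_eq
  by (rule norm_blinfun_bound)
    (simp_all add: shift.rep_eq bounded_linear_Blinfun_apply[OF bounded_linear_l2_shift] norm_l2_shift)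

text \<open>Operators \<open>\<Sum>\<^sub>y c\<^sub>y \<tau>\<^sup>y\<close> with absolutely summable matrix coefficients: the same majorant gives
  convergence of the operators in norm and, by the M-test, uniform convergence of the symbols.\<close>

lemma has_symbol_convolution:
  assumes \<alpha>: "norm \<alpha> = 1" and c: "(\<lambda>y. norm (c y)) summable_on UNIV"
    and M: "\<And>\<theta>. ((\<lambda>y. mat ((exp (\<i> * of_real \<theta>) / \<alpha>) powi y) ** c y) has_sum M \<theta>) UNIV"
  shows "has_symbol \<alpha> (\<Sum>\<^sub>\<infinity>y. matrix_op (c y) * shift y) M"
proof -
  have \<alpha>0: "\<alpha> \<noteq> 0" using \<alpha> by auto
  have "(\<lambda>y. norm (matrix_op (c y) * shift y)) summable_on UNIV"
  proof (rule Infinite_Sum.abs_summable_on_comparison_test')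
    show "(\<lambda>y. 4 * norm (c y)) summable_on UNIV" by (intro summable_on_cmult_right c)
    fix y
    have "norm (matrix_op (c y) * shift y) \<le> norm (matrix_op (c y)) * norm (shift y)"
      by (rule norm_mult_ineq)
    also have "\<dots> \<le> (4 * norm (c y)) * 1"
      by (intro mult_mono norm_matrix_op_le norm_shift_le) auto
    finally show "norm (matrix_op (c y) * shift y) \<le> 4 * norm (c y)" by simp
  qed
  then have "(\<lambda>y. matrix_op (c y) * shift y) summable_on UNIV"
    by (rule abs_summable_summable)
  then have lim: "((\<lambda>F. \<Sum>y\<in>F. matrix_op (c y) * shift y) \<longlongrightarrow> (\<Sum>\<^sub>\<infinity>y. matrix_op (c y) * shift y))
      (finite_subsets_at_top UNIV)"
    by (simp add: has_sum_def[symmetric])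
  have "norm (mat ((exp (\<i> * of_real \<theta>) / \<alpha>) powi y) ** c y) \<le> norm (c y)" for \<theta> y
    by (simp add: norm_mat_mult norm_power_int norm_divide \<alpha>)
  then have ul: "uniform_limit {0..2 * pi}
      (\<lambda>F \<theta>. \<Sum>y\<in>F. mat ((exp (\<i> * of_real \<theta>) / \<alpha>) powi y) ** c y) M (finite_subsets_at_top UNIV)"
    by (rule Weierstrass_m_test_general'[OF _ M c])
  have "has_symbol \<alpha> (matrix_op (c y) * shift y) (\<lambda>\<theta>. mat ((exp (\<i> * of_real \<theta>) / \<alpha>) powi y) ** c y)" for y
    using has_symbol_mult[OF has_symbol_matrix has_symbol_shift[OF \<alpha>0]]
    by (simp only: mult_mat_commute)
  then have "has_symbol \<alpha> (\<Sum>y\<in>F. matrix_op (c y) * shift y)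
      (\<lambda>\<theta>. \<Sum>y\<in>F. mat ((exp (\<i> * of_real \<theta>) / \<alpha>) powi y) ** c y)" for F
    by (rule has_symbol_sum)
  from has_symbol_uniform_limit[OF this lim ul] show ?thesis by simp
qed

lemma has_sum_vec:
  assumes "\<And>i. ((\<lambda>x. f x $ i) has_sum S $ i) A"
  shows "(f has_sum S) A"
  unfolding has_sum_def
  by (rule vec_tendstoI) (use assms in \<open>simp add: has_sum_def\<close>)

lemma has_sum_mat:
  fixes f :: "'i \<Rightarrow> complex^2^2"
  assumes "((\<lambda>x. f x $ 1 $ 1) has_sum S $ 1 $ 1) A" "((\<lambda>x. f x $ 1 $ 2) has_sum S $ 1 $ 2) A"
    "((\<lambda>x. f x $ 2 $ 1) has_sum S $ 2 $ 1) A" "((\<lambda>x. f x $ 2 $ 2) has_sum S $ 2 $ 2) A"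
  shows "(f has_sum S) A"
proof (rule has_sum_vec, rule has_sum_vec)
  fix i j :: 2
  show "((\<lambda>x. f x $ i $ j) has_sum S $ i $ j) A"
    using assms exhaust_2[of i] exhaust_2[of j] by (elim disjE) simp_all
qed

section \<open>The symbols of the walk and of its logarithm\<close>

locale special_unitary_coin =
  fixes a b :: complex
  assumes norm_ab: "(cmod a)\<^sup>2 + (cmod b)\<^sup>2 = 1" and ab0: "a * b \<noteq> 0"
begin

definition s :: real where "s = cmod a"

definition \<alpha> :: complex where "\<alpha> = a / s"

lemma coin_bounds: "0 < s" "s < 1" "a \<noteq> 0" "b \<noteq> 0" "norm \<alpha> = 1" "\<alpha> \<noteq> 0" "cmod b \<le> 1" "0 < cmod b"
proof -
  show a: "a \<noteq> 0" and b: "b \<noteq> 0" using ab0 by auto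
  then show s0: "0 < s" and b0: "0 < cmod b" by (auto simp: s_def)
  have "s\<^sup>2 < 1\<^sup>2" using norm_ab zero_less_power[OF b0, of 2] unfolding s_def power_one by linarith
  then show "s < 1" by (rule power_less_imp_less_base) simp
  have "(cmod b)\<^sup>2 \<le> 1\<^sup>2" using norm_ab zero_le_power2[of "cmod a"] unfolding power_one by linarith
  then show "cmod b \<le> 1" by (rule power2_le_imp_le) simp
  show "norm \<alpha> = 1" "\<alpha> \<noteq> 0" using a by (auto simp: \<alpha>_def s_def norm_divide)
qed

lemma a_eq: "a = s * \<alpha>" and cnj_a: "cnj a * \<alpha> = s" and cnj_b: "cmod b * inverse (b / cmod b) = cnj b"
proof -
  show "a = s * \<alpha>" using coin_bounds by (simp add: s_def \<alpha>_def)
  show "cnj a * \<alpha> = s"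
    using coin_bounds complex_norm_square[of a] by (simp add: \<alpha>_def s_def field_simps power2_eq_square)
  show "cmod b * inverse (b / cmod b) = cnj b"
    using coin_bounds complex_norm_square[of b] by (simp add: field_simps power2_eq_square)
qed

text \<open>The symbol of the shift \<open>\<tau>\<close>.\<close>

definition z where "z \<theta> = exp (\<i> * of_real \<theta>) / \<alpha>"

lemma z_nz: "z \<theta> \<noteq> 0" and alpha_z: "\<alpha> * z \<theta> = exp (\<i> * of_real \<theta>)" and norm_z: "norm (z \<theta>) = 1"
  using coin_bounds by (simp_all add: z_def norm_divide)

lemma alpha_z_powi: "\<alpha> powi y * z \<theta> powi y = exp (\<i> * of_int y * of_real \<theta>)"
  unfolding power_int_mult_distrib[symmetric] alpha_z exp_power_int by (simp add: mult_ac)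

definition phase_ratio where "phase_ratio \<theta> = complex_of_real (phase s \<theta> / sin (phase s \<theta>))"

lemma J_sum: "(\<lambda>y. norm (J_coeff s y)) summable_on UNIV"
    "((\<lambda>y. J_coeff s y * exp (\<i> * of_int y * of_real \<theta>)) has_sum phase_ratio \<theta>) UNIV"
  and I_sum: "(\<lambda>y. norm (I_coeff s y)) summable_on UNIV"
    "((\<lambda>y. I_coeff s y * exp (\<i> * of_int y * of_real \<theta>)) has_sum complex_of_real (sin \<theta>) * phase_ratio \<theta>) UNIV"
proof -
  have J: "J_coeff s = fourier_coeff phase_ratio"
    unfolding J_coeff_def fourier_coeff_def phase_ratio_def by (rule ext) (rule refl)
  have I: "I_coeff s = fourier_coeff (\<lambda>\<theta>. complex_of_real (sin \<theta>) * phase_ratio \<theta>)"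
    unfolding I_coeff_def fourier_coeff_def phase_ratio_def of_real_mult by (rule ext) (rule refl)
  obtain L where L: "absolute_fourier phase_ratio L"
    using absolute_fourier_phase[of s] coin_bounds unfolding phase_ratio_def by auto
  show "(\<lambda>y. norm (J_coeff s y)) summable_on UNIV"
    "((\<lambda>y. J_coeff s y * exp (\<i> * of_int y * of_real \<theta>)) has_sum phase_ratio \<theta>) UNIV"
    using L unfolding J absolute_fourier_def by blast+
  show "(\<lambda>y. norm (I_coeff s y)) summable_on UNIV"
    "((\<lambda>y. I_coeff s y * exp (\<i> * of_int y * of_real \<theta>)) has_sum complex_of_real (sin \<theta>) * phase_ratio \<theta>) UNIV"
    using absolute_fourier_sin[OF L] unfolding I absolute_fourier_def by blast+
qed

lemma phase_facts:
  shows cos_phase: "cos (phase s \<theta>) = s * cos \<theta>"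
    and sin_phase_sq: "(sin (phase s \<theta>))\<^sup>2 = s\<^sup>2 * (sin \<theta>)\<^sup>2 + (cmod b)\<^sup>2"
    and sin_phase_ge: "cmod b \<le> sin (phase s \<theta>)"
    and phase_bounds: "0 \<le> phase s \<theta>" "phase s \<theta> \<le> pi"
proof -
  have "\<bar>s * cos \<theta>\<bar> \<le> 1 * 1"
    unfolding abs_mult by (rule mult_mono) (use coin_bounds in auto)
  then have u: "- 1 \<le> s * cos \<theta>" "s * cos \<theta> \<le> 1" by auto
  show c: "cos (phase s \<theta>) = s * cos \<theta>"
    unfolding phase_def by (rule cos_arccos[OF u])
  show p: "0 \<le> phase s \<theta>" "phase s \<theta> \<le> pi"
    unfolding phase_def by (rule arccos_lbound[OF u], rule arccos_ubound[OF u])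
  have "(sin (phase s \<theta>))\<^sup>2 = 1 - s\<^sup>2 * (cos \<theta>)\<^sup>2"
    using sin_cos_squared_add[of "phase s \<theta>"] unfolding c power_mult_distrib by linarith
  also have "\<dots> = s\<^sup>2 * (sin \<theta>)\<^sup>2 + (cmod b)\<^sup>2"
    using norm_ab unfolding s_def cos_squared_eq by (simp add: algebra_simps)
  finally show q: "(sin (phase s \<theta>))\<^sup>2 = s\<^sup>2 * (sin \<theta>)\<^sup>2 + (cmod b)\<^sup>2" .
  then have "(cmod b)\<^sup>2 \<le> (sin (phase s \<theta>))\<^sup>2" by simp
  then show "cmod b \<le> sin (phase s \<theta>)"
    by (rule power2_le_imp_le) (rule sin_ge_zero[OF p])
qed

lemma sin_phase_pos: "0 < sin (phase s \<theta>)"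
  using sin_phase_ge[of \<theta>] coin_bounds by linarith

text \<open>With \<open>\<phi>\<close> the phase at \<open>\<theta>\<close>, the symbol \<open>u\<close> of the walk has determinant 1 and trace \<open>2 cos \<phi>\<close>,
  so its eigenvalues are \<open>e\<^sup>i\<^sup>\<phi>\<close> and \<open>e\<^sup>-\<^sup>i\<^sup>\<phi>\<close>. The matrix below is \<open>(u - cos \<phi>) / (i sin \<phi>)\<close>: the Hermitian
  reflection with eigenvalues 1 and -1 on the two eigenspaces.\<close>

definition direction where "direction \<theta> = mat (1 / of_real (sin (phase s \<theta>))) **
  mat2 (s * sin \<theta>) (- \<i> * b / z \<theta>) (\<i> * cnj b * z \<theta>) (- s * sin \<theta>)"

lemma direction_square: "direction \<theta> ** direction \<theta> = mat 1"
proof -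
  define q where "q = complex_of_real (sin (phase s \<theta>))"
  have q: "q \<noteq> 0" using sin_phase_pos[of \<theta>] by (simp add: q_def)
  have "q\<^sup>2 = of_real (s\<^sup>2 * (sin \<theta>)\<^sup>2 + (cmod b)\<^sup>2)"
    unfolding q_def sin_phase_sq[symmetric] by simp
  moreover have "b * cnj b = of_real ((cmod b)\<^sup>2)"
    by (rule complex_norm_square[symmetric])
  ultimately have q2: "(s * sin \<theta>) * (s * sin \<theta>) + b * cnj b = q * q"
    by (simp add: power2_eq_square mult_ac)
  define x where "x = - \<i> * b / z \<theta>"
  define y where "y = \<i> * cnj b * z \<theta>"
  have "x * y = b * cnj b" using z_nz[of \<theta>] by (simp add: x_def y_def mult.left_commute[of b \<i>])
  then have sq: "mat2 (s * sin \<theta>) x y (- s * sin \<theta>) ** mat2 (s * sin \<theta>) x y (- s * sin \<theta>) = mat (q * q)"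
    using q2 by (simp add: mat_eq_iff2 matrix_matrix_mult_def sum_2 mat_def mult.commute[of y]
        add.commute[of "b * cnj b"])
  show ?thesis
    unfolding direction_def mat_mult_mat_mult q_def[symmetric] x_def[symmetric] y_def[symmetric]
      sq mat_eq_iff2 mat_mult_nth
    using q by (simp add: mat_def)
qed

lemma norm_direction_le: "norm (direction \<theta>) \<le> 4 / cmod b"
proof -
  have "norm (mat2 (s * sin \<theta>) (- \<i> * b / z \<theta>) (\<i> * cnj b * z \<theta>) (- s * sin \<theta>))
      \<le> s * \<bar>sin \<theta>\<bar> + cmod b + cmod b + s * \<bar>sin \<theta>\<bar>"
    using coin_bounds norm_mat_le[of "mat2 (s * sin \<theta>) (- \<i> * b / z \<theta>) (\<i> * cnj b * z \<theta>) (- s * sin \<theta>)"]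
    by (simp add: norm_mult norm_divide norm_z)
  moreover have "s * \<bar>sin \<theta>\<bar> \<le> 1 * 1" by (rule mult_mono) (use coin_bounds in auto)
  ultimately have n: "norm (mat2 (s * sin \<theta>) (- \<i> * b / z \<theta>) (\<i> * cnj b * z \<theta>) (- s * sin \<theta>)) \<le> 4"
    using coin_bounds by linarith
  have "norm (1 / complex_of_real (sin (phase s \<theta>))) \<le> 1 / cmod b"
    using sin_phase_pos[of \<theta>] sin_phase_ge[of \<theta>] coin_bounds(8) by (simp add: norm_divide frac_le)
  with n have "norm (direction \<theta>) \<le> 1 / cmod b * 4"
    unfolding direction_def norm_mat_mult by (intro mult_mono) auto
  then show ?thesis by simp
qed

text \<open>All parameters of the coefficients are read off from the first row of the coin. The identity
  \<open>r \<beta>\<^sup>-\<^sup>1 = cnj b\<close> removes \<open>\<beta>\<close>.\<close>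

lemma D_coeff_mat2:
  "D_coeff (mat2 a b u v) y = mat2
    (s * \<alpha> powi y * I_coeff s y)
    (- \<i> * b * \<alpha> powi (y + 1) * J_coeff s (y + 1))
    (\<i> * cnj b * \<alpha> powi (y - 1) * J_coeff s (y - 1))
    (- s * \<alpha> powi y * I_coeff s y)"
proof -
  have "\<i> * cmod b * x * inverse (b / cmod b) = \<i> * cnj b * x" for x
    unfolding cnj_b[symmetric] by simp
  moreover have "- \<i> * cmod b * x * (b / cmod b) = - \<i> * b * x" for x
    using coin_bounds by simp
  ultimately show ?thesis
    unfolding D_coeff_def Let_def mat2_nth \<alpha>_def s_def mat2_def[symmetric] by (simp only:)
qed

lemma summable_D_coeff: "(\<lambda>y. norm (D_coeff (mat2 a b u v) y)) summable_on UNIV"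
proof (rule Infinite_Sum.abs_summable_on_comparison_test')
  note bij = bij_int_shift[of "- 1"] bij_int_shift[of 1]
  note J = summable_on_reindex_bij_betw[OF bij(1), of "\<lambda>y. norm (J_coeff s y)"]
    summable_on_reindex_bij_betw[OF bij(2), of "\<lambda>y. norm (J_coeff s y)"]
  show "(\<lambda>y. norm (I_coeff s y) + norm (J_coeff s (y + 1)) + norm (J_coeff s (y - 1)) + norm (I_coeff s y))
      summable_on UNIV"
    using J J_sum by (intro summable_on_add I_sum(1)) simp_all
  fix y
  have le: "s * x \<le> x" "cmod b * x \<le> x" if "0 \<le> x" for x
    using that coin_bounds by (auto intro: mult_left_le_one_le)
  have "norm (D_coeff (mat2 a b u v) y $ 1 $ 1) = s * norm (I_coeff s y)"
    "norm (D_coeff (mat2 a b u v) y $ 1 $ 2) = cmod b * norm (J_coeff s (y + 1))"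
    "norm (D_coeff (mat2 a b u v) y $ 2 $ 1) = cmod b * norm (J_coeff s (y - 1))"
    "norm (D_coeff (mat2 a b u v) y $ 2 $ 2) = s * norm (I_coeff s y)"
    unfolding D_coeff_mat2 mat2_nth norm_mult norm_power_int
    using coin_bounds by simp_all
  then show "norm (D_coeff (mat2 a b u v) y)
      \<le> norm (I_coeff s y) + norm (J_coeff s (y + 1)) + norm (J_coeff s (y - 1)) + norm (I_coeff s y)"
    using norm_mat_le[of "D_coeff (mat2 a b u v) y"] le(1)[of "norm (I_coeff s y)"]
      le(2)[of "norm (J_coeff s (y + 1))"] le(2)[of "norm (J_coeff s (y - 1))"]
    by simp
qed

text \<open>Each factor \<open>\<alpha>\<^sup>x\<close> in the coefficient of \<open>\<tau>\<^sup>y\<close> joins \<open>z\<^sup>y\<close> to form \<open>e\<^sup>i\<^sup>x\<^sup>\<theta>\<close>. In the off-diagonal entries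
  \<open>x = y + 1\<close> and \<open>x = y - 1\<close>, and the mismatch leaves the factors \<open>1 / z\<close> and \<open>z\<close> of the
  reflection.\<close>

lemma D_coeff_has_sum:
  "((\<lambda>y. mat (z \<theta> powi y) ** D_coeff (mat2 a b u v) y) has_sum mat (of_real (phase s \<theta>)) ** direction \<theta>) UNIV"
proof (rule has_sum_mat)
  let ?e = "\<lambda>y. exp (\<i> * of_int y * complex_of_real \<theta>)"
  note J = has_sum_reindex_bij_betw[OF bij_int_shift, of "\<lambda>y. J_coeff s y * ?e y" _ "phase_ratio \<theta>", THEN iffD2, OF J_sum(2)]
  note comp = D_coeff_mat2 mat_mult_nth mat2_nth direction_def
  have p: "of_real (phase s \<theta>) * (1 / of_real (sin (phase s \<theta>)) * x) = x * phase_ratio \<theta>" for x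
    by (simp add: phase_ratio_def)
  have e0: "z \<theta> powi y * (c * \<alpha> powi y * w) = c * (w * ?e y)" for c y w
    by (simp add: alpha_z_powi[symmetric])
  have e1: "z \<theta> powi y * (c * \<alpha> powi (y + 1) * w) = c / z \<theta> * (w * ?e (y + 1))" for c y w
    unfolding alpha_z_powi[symmetric] using z_nz[of \<theta>] by (simp add: power_int_add)
  have e2: "z \<theta> powi y * (c * \<alpha> powi (y - 1) * w) = c * z \<theta> * (w * ?e (y - 1))" for c y w
    unfolding alpha_z_powi[symmetric] using z_nz[of \<theta>] by (simp add: power_int_diff)
  show "((\<lambda>y. (mat (z \<theta> powi y) ** D_coeff (mat2 a b u v) y) $ 1 $ 1)
      has_sum (mat (of_real (phase s \<theta>)) ** direction \<theta>) $ 1 $ 1) UNIV"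
    unfolding comp p e0 using has_sum_cmult_right[OF I_sum(2), of s] by (simp add: mult.assoc)
  show "((\<lambda>y. (mat (z \<theta> powi y) ** D_coeff (mat2 a b u v) y) $ 2 $ 2)
      has_sum (mat (of_real (phase s \<theta>)) ** direction \<theta>) $ 2 $ 2) UNIV"
    unfolding comp p e0 using has_sum_cmult_right[OF I_sum(2), of "- s"] by (simp add: mult.assoc)
  show "((\<lambda>y. (mat (z \<theta> powi y) ** D_coeff (mat2 a b u v) y) $ 1 $ 2)
      has_sum (mat (of_real (phase s \<theta>)) ** direction \<theta>) $ 1 $ 2) UNIV"
    unfolding comp p e1 using has_sum_cmult_right[OF J[of "- 1"], of "- \<i> * b / z \<theta>"] by simp
  show "((\<lambda>y. (mat (z \<theta> powi y) ** D_coeff (mat2 a b u v) y) $ 2 $ 1)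
      has_sum (mat (of_real (phase s \<theta>)) ** direction \<theta>) $ 2 $ 1) UNIV"
    unfolding comp p e2 using has_sum_cmult_right[OF J[of 1], of "\<i> * cnj b * z \<theta>"] by simp
qed

lemma has_symbol_D_op:
  "has_symbol \<alpha> (D_op (mat2 a b u v)) (\<lambda>\<theta>. mat (of_real (phase s \<theta>)) ** direction \<theta>)"
  unfolding D_op_def
  by (rule has_symbol_convolution[OF coin_bounds(5) summable_D_coeff D_coeff_has_sum[unfolded z_def]])

lemma has_symbol_exp_D_op:
  "has_symbol \<alpha> (exp (\<i> *\<^sub>C D_op (mat2 a b u v)))
    (\<lambda>\<theta>. mat (cosh (\<i> * of_real (phase s \<theta>))) + mat (sinh (\<i> * of_real (phase s \<theta>))) ** direction \<theta>)"
proof (rule has_symbol_exp[OF _ direction_square _ norm_direction_le])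
  show "has_symbol \<alpha> (\<i> *\<^sub>C D_op (mat2 a b u v)) (\<lambda>\<theta>. mat (\<i> * of_real (phase s \<theta>)) ** direction \<theta>)"
    using has_symbol_scaleC[OF has_symbol_D_op, of \<i>] mat_mult_mat_mult[of _ "mat 1"]
    by simp
  show "norm (\<i> * complex_of_real (phase s \<theta>)) \<le> pi" for \<theta>
    using phase_bounds[of \<theta>] by (simp add: norm_mult)
qed

text \<open>Entry by entry this is Euler's formula: \<open>a z = s e\<^sup>i\<^sup>\<theta>\<close> on the diagonal, while off the diagonal \<open>sin \<phi>\<close>
  cancels.\<close>

lemma has_symbol_quantum_walk:
  "has_symbol \<alpha> (quantum_walk (mat2 a b (- cnj b) (cnj a)))
    (\<lambda>\<theta>. mat (cosh (\<i> * of_real (phase s \<theta>))) + mat (sinh (\<i> * of_real (phase s \<theta>))) ** direction \<theta>)"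
proof -
  have *: "mat2 a b (- cnj b) (cnj a) ** proj 1 ** mat (z \<theta> powi 1)
      + mat2 a b (- cnj b) (cnj a) ** proj 2 ** mat (z \<theta> powi (- 1))
    = mat (cosh (\<i> * of_real (phase s \<theta>))) + mat (sinh (\<i> * of_real (phase s \<theta>))) ** direction \<theta>" for \<theta>
  proof -
    have p: "mat2 a b (- cnj b) (cnj a) ** proj 1 = mat2 a 0 (- cnj b) 0"
      "mat2 a b (- cnj b) (cnj a) ** proj 2 = mat2 0 b 0 (cnj a)"
      by (simp_all add: mat_eq_iff2 matrix_matrix_mult_def proj_def sum_2)
    have c: "cosh (\<i> * of_real (phase s \<theta>)) = s * cos \<theta>"
      by (simp add: cosh_conv_cos mult.assoc[symmetric] cos_of_real cos_phase)
    have si: "sinh (\<i> * of_real (phase s \<theta>)) = \<i> * of_real (sin (phase s \<theta>))"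
      by (simp add: sinh_conv_sin mult.assoc[symmetric] sin_of_real)
    have sd: "sinh (\<i> * of_real (phase s \<theta>)) * (1 / of_real (sin (phase s \<theta>)) * x) = \<i> * x" for x
      unfolding si using sin_phase_pos[of \<theta>] by simp
    have az: "a * z \<theta> = s * cos \<theta> + \<i> * (s * sin \<theta>)"
    proof -
      have "a * z \<theta> = s * (\<alpha> * z \<theta>)" by (subst a_eq) simp
      also have "\<dots> = s * (cos \<theta> + \<i> * sin \<theta>)"
        unfolding alpha_z exp_Euler by (simp only: sin_of_real cos_of_real)
      finally show ?thesis by (simp add: algebra_simps)
    qed
    have caz: "cnj a / z \<theta> = s * cos \<theta> - \<i> * (s * sin \<theta>)"
    proof -
      have "cnj a / z \<theta> = (cnj a * \<alpha>) / (\<alpha> * z \<theta>)"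
        using coin_bounds(6) by simp
      also have "\<dots> = s * exp (- (\<i> * of_real \<theta>))"
        unfolding cnj_a alpha_z by (simp add: exp_minus divide_inverse)
      also have "\<dots> = s * (cos \<theta> - \<i> * sin \<theta>)"
        using exp_Euler[of "- of_real \<theta>"] by (simp add: sin_of_real cos_of_real)
      finally show ?thesis by (simp add: algebra_simps)
    qed
    show ?thesis
      unfolding p mult_mat_commute[of "mat2 _ _ _ _"] mat_eq_iff2 vector_add_component mat_mult_nth
        mat2_nth direction_def sd c
      using az caz by (simp add: mat_def power_int_minus divide_inverse mult_ac)
  qed
  show ?thesis
    unfolding quantum_walk_def *[symmetric] z_def
    by (intro has_symbol_add has_symbol_mult has_symbol_matrix has_symbol_shift coin_bounds)
qed

end

theorem theorem1:
  fixes a b :: complex and T :: "complex^2^2"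
  assumes "T = vector [vector [a, b], vector [- cnj b, cnj a]]"
    and "(cmod a)\<^sup>2 + (cmod b)\<^sup>2 = 1"
    and "a * b \<noteq> 0"
  shows "quantum_walk T = exp (\<i> *\<^sub>C D_op T)"
proof -
  interpret special_unitary_coin a b
    by unfold_locales (fact assms(2), fact assms(3))
  show ?thesis
    unfolding assms(1) mat2_def[symmetric]
    using has_symbol_quantum_walk has_symbol_exp_D_op coin_bounds(6) by (rule has_symbol_unique)
qed

end
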